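(* Let $W=\mathbb N$ and $S=\mathbb N$. There exist $p:\mathbb N\times\mathbb N\to[0,\infty)$ and a bounded $b:\mathbb N\times\mathbb N\to[0,\infty)$ satisfying the standing assumptions in the context, and a parameter $\lambda\in[0,\lambda^* )^{\mathbb N}$ with $\sum_i\lambda_i=\infty$, such that the product measure $\mu_\lambda$ is stationary, i.e. $\mu_\lambda\in\mathcal I(L^{b,p})$, and concentrates on configurations with infinitely many particles, i.e. $\mu_\lambda\big(\sum_i\eta_i=\infty\big)=1$, but $\mu_\lambda$ is not ergodic.
   Context: $\mathbb N=\{0,1,2,\dots\}$; $E=\mathbb N^{\mathbb N}$ with product topology and product $\sigma$-algebra $\mathcal B$. $\eta^{x,y}=\eta-\delta_x+\delta_y$. For $f:E\to\mathbb R$, $\Delta_f(i)=\sup\{|f(\eta)-f(\zeta)|:\eta_j=\zeta_j\ \forall j\ne i\}$ and $D=\{f\in C_b(E):\sum_x\Delta_f(x)<\infty\}$, with uniform closure $\overline D$. For $f\in D$, $$L^{b,p}f(\eta)=\sum_{x,y}p(x,y)\,b(\eta_x,\eta_y)\,(f(\eta^{x,y})-f(\eta)),$$ where terms with $b(\eta_x,\eta_y)=0$ are read as $0$. Standing assumptions: (1) $p$ is finite range (for each $x$ only finitely many $y$ have $p(x,y)+p(y,x)>0$) and $\sup_x\sum_y(p(x,y)+p(y,x))<\infty$. (2) $p$ is irreducible and $b$ is strictly positive except that $b(0,\cdot)=0$. (3) For all $i\ge0,j\ge1$, $\dfrac{b(i+1,j-1)}{b(j,i)}=\dfrac{b(1,j-1)}{b(j,0)}\dfrac{b(i+1,0)}{b(1,i)}$.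 (4) $\inf_i\frac{b(i+1,0)}{b(1,i)}>0$. Then $L^{b,p}$ generates a Markov semigroup $S_t$ on $\overline D$ with core $D$. $\mathcal I(L^{b,p})$ is the set of stationary probability measures, equivalently $\{\mu:\int L^{b,p}f\,d\mu=0\ \forall f\in D\}$. For $\mu\in\mathcal I(L^{b,p})$, $S_t$ extends to a contraction semigroup $S_t^\mu$ on $L^2(\mu)$; $\mu$ is ergodic if every $A\in\mathcal B$ with $S^\mu_t\mathbf 1_A=\mathbf 1_A$ $\mu$-a.s. for all $t\ge0$ has $\mu(A)\in\{0,1\}$. Product measures: $a_0=1$, $a_k=\prod_{i=0}^{k-1}\frac{b(1,i)}{b(i+1,0)}$, $Z_\lambda=\sum_{k}a_k\lambda^k$, $\lambda^*=\liminf_j\frac{b(j+1,0)}{b(1,j)}\in(0,\infty]$. For $\lambda\in[0,\lambda^* )^{\mathbb N}$, $\mu_\lambda=\bigotimes_{x}\mu_{\lambda_x}$ with $\mu_{\lambda_x}(n)=Z_{\lambda_x}^{-1}a_n\lambda_x^n$. *)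

theory Defs
  imports "HOL-Probability.Probability"
begin

type_synonym config = "nat \<Rightarrow> nat"

text \<open>
  The type \<^typ>\<open>nat \<Rightarrow> nat\<close> carries the product topology of the discrete topologies, and
  \<^typ>\<open>config \<Rightarrow>\<^sub>C real\<close> is the Banach space of bounded continuous functions with the supremum
  norm, so that \<^const>\<open>closure\<close> is the uniform closure.
\<close>

definition config_space :: "config measure" where
  "config_space = PiM UNIV (\<lambda>_. count_space UNIV)"

subsection \<open>The operator\<close>

definition oscillation :: "(config \<Rightarrow> real) \<Rightarrow> nat \<Rightarrow> real" where
  "oscillation f i = Sup {\<bar>f \<eta> - f \<zeta>\<bar> | \<eta> \<zeta>. \<forall>j. j \<noteq> i \<longrightarrow> \<eta> j = \<zeta> j}"

definition core_D :: "(config \<Rightarrow>\<^sub>C real) set" where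
  "core_D = {f. summable (oscillation (apply_bcontfun f))}"

text \<open>The natural number subtraction is exact when \<open>\<eta> x \<ge> 1\<close>, also in the case \<open>x = y\<close>. In
  \<open>generator_L\<close> the configurations with \<open>\<eta> x = 0\<close> have rate \<open>b 0 _ = 0\<close>.\<close>

definition jump :: "config \<Rightarrow> nat \<Rightarrow> nat \<Rightarrow> config" where
  "jump \<eta> x y = (\<lambda>z. \<eta> z - of_bool (z = x) + of_bool (z = y))"

definition generator_L ::
  "(nat \<Rightarrow> nat \<Rightarrow> real) \<Rightarrow> (nat \<Rightarrow> nat \<Rightarrow> real) \<Rightarrow> (config \<Rightarrow> real) \<Rightarrow> config \<Rightarrow> real" where
  "generator_L b p f \<eta> =
     (\<Sum>\<^sub>\<infinity>(x, y)\<in>UNIV. p x y * b (\<eta> x) (\<eta> y) * (f (jump \<eta> x y) - f \<eta>))"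

definition standing_assumptions :: "(nat \<Rightarrow> nat \<Rightarrow> real) \<Rightarrow> (nat \<Rightarrow> nat \<Rightarrow> real) \<Rightarrow> bool" where
  "standing_assumptions b p \<longleftrightarrow>
     (\<forall>x y. p x y \<ge> 0) \<and>
     (\<forall>x. finite {y. p x y + p y x > 0}) \<and>
     bdd_above (range (\<lambda>x. \<Sum>\<^sub>\<infinity>y. p x y + p y x)) \<and>
     (\<forall>x y. (x, y) \<in> {(u, v). p u v > 0}\<^sup>*) \<and>
     (\<forall>j. b 0 j = 0) \<and>
     (\<forall>i j. i \<ge> 1 \<longrightarrow> b i j > 0) \<and>
     (\<forall>i j. j \<ge> 1 \<longrightarrow>
        b (i + 1) (j - 1) / b j i = (b 1 (j - 1) / b j 0) * (b (i + 1) 0 / b 1 i)) \<and>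
     (INF i. b (i + 1) 0 / b 1 i) > 0"

subsection \<open>Markov semigroups and stationary measures\<close>

definition markov_semigroup :: "(real \<Rightarrow> (config \<Rightarrow>\<^sub>C real) \<Rightarrow> (config \<Rightarrow>\<^sub>C real)) \<Rightarrow> bool" where
  "markov_semigroup S \<longleftrightarrow>
     (\<forall>t\<ge>0. \<forall>f\<in>closure core_D. S t f \<in> closure core_D) \<and>
     (\<forall>t\<ge>0. \<forall>f\<in>closure core_D. \<forall>g\<in>closure core_D. S t (f + g) = S t f + S t g) \<and>
     (\<forall>t\<ge>0. \<forall>c. \<forall>f\<in>closure core_D. S t (c *\<^sub>R f) = c *\<^sub>R S t f) \<and>
     (\<forall>f\<in>closure core_D. S 0 f = f) \<and>
     (\<forall>s\<ge>0. \<forall>t\<ge>0. \<forall>f\<in>closure core_D. S (s + t) f = S s (S t f)) \<and>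
     (\<forall>f\<in>closure core_D. ((\<lambda>t. S t f) \<longlongrightarrow> f) (at_right 0)) \<and>
     (\<forall>t\<ge>0. S t (const_bcontfun 1) = const_bcontfun 1) \<and>
     (\<forall>t\<ge>0. \<forall>f\<in>closure core_D. (\<forall>\<eta>. apply_bcontfun f \<eta> \<ge> 0) \<longrightarrow>
        (\<forall>\<eta>. apply_bcontfun (S t f) \<eta> \<ge> 0))"

text \<open>The operators are identified with their graphs: the infinitesimal generator of \<open>S\<close> is the
  closure of \<open>generator_L b p\<close> restricted to \<open>core_D\<close>. In particular \<open>core_D\<close> is a core.\<close>

definition generates ::
  "(nat \<Rightarrow> nat \<Rightarrow> real) \<Rightarrow> (nat \<Rightarrow> nat \<Rightarrow> real) \<Rightarrow>
   (real \<Rightarrow> (config \<Rightarrow>\<^sub>C real) \<Rightarrow> (config \<Rightarrow>\<^sub>C real)) \<Rightarrow> bool" where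
  "generates b p S \<longleftrightarrow>
     markov_semigroup S \<and>
     (\<forall>f\<in>core_D. \<exists>g\<in>closure core_D. apply_bcontfun g = generator_L b p (apply_bcontfun f)) \<and>
     {(f, g). f \<in> closure core_D \<and> g \<in> closure core_D \<and>
        ((\<lambda>t. (S t f - f) /\<^sub>R t) \<longlongrightarrow> g) (at_right 0)}
     = closure {(f, g). f \<in> core_D \<and>
        apply_bcontfun g = generator_L b p (apply_bcontfun f)}"

definition stationary_measures ::
  "(real \<Rightarrow> (config \<Rightarrow>\<^sub>C real) \<Rightarrow> (config \<Rightarrow>\<^sub>C real)) \<Rightarrow> config measure set" where
  "stationary_measures S = {\<mu>. prob_space \<mu> \<and> sets \<mu> = sets config_space \<and>
     (\<forall>t\<ge>0. \<forall>f\<in>closure core_D.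
        (\<integral>\<eta>. apply_bcontfun (S t f) \<eta> \<partial>\<mu>) = (\<integral>\<eta>. apply_bcontfun f \<eta> \<partial>\<mu>))}"

subsection \<open>The extension to square integrable functions, and ergodicity\<close>

definition square_integrable :: "config measure \<Rightarrow> (config \<Rightarrow> real) \<Rightarrow> bool" where
  "square_integrable \<mu> f \<longleftrightarrow> f \<in> borel_measurable \<mu> \<and> integrable \<mu> (\<lambda>\<eta>. (f \<eta>)\<^sup>2)"

definition L2_converges ::
  "config measure \<Rightarrow> (nat \<Rightarrow> config \<Rightarrow>\<^sub>C real) \<Rightarrow> (config \<Rightarrow> real) \<Rightarrow> bool" where
  "L2_converges \<mu> F f \<longleftrightarrow>
     (\<lambda>n. \<integral>\<eta>. (apply_bcontfun (F n) \<eta> - f \<eta>)\<^sup>2 \<partial>\<mu>) \<longlonglongrightarrow> 0"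

text \<open>For stationary \<open>\<mu>\<close> each \<open>S t\<close> is a contraction with respect to the L2(\<open>\<mu>\<close>) norm on the dense
  subspace \<^term>\<open>closure core_D\<close>. It is extended by continuity; the result is a representative,
  determined up to \<open>\<mu>\<close>-null sets.\<close>

definition L2_extension ::
  "(real \<Rightarrow> (config \<Rightarrow>\<^sub>C real) \<Rightarrow> (config \<Rightarrow>\<^sub>C real)) \<Rightarrow> config measure \<Rightarrow>
   real \<Rightarrow> (config \<Rightarrow> real) \<Rightarrow> config \<Rightarrow> real" where
  "L2_extension S \<mu> t f = (SOME g. square_integrable \<mu> g \<and>
     (\<forall>F. (\<forall>n. F n \<in> closure core_D) \<longrightarrow> L2_converges \<mu> F f \<longrightarrow>
        L2_converges \<mu> (\<lambda>n. S t (F n)) g))"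

definition ergodic ::
  "(real \<Rightarrow> (config \<Rightarrow>\<^sub>C real) \<Rightarrow> (config \<Rightarrow>\<^sub>C real)) \<Rightarrow> config measure \<Rightarrow> bool" where
  "ergodic S \<mu> \<longleftrightarrow> (\<forall>A\<in>sets config_space.
     (\<forall>t\<ge>0. AE \<eta> in \<mu>. L2_extension S \<mu> t (indicator A) \<eta> = indicator A \<eta>) \<longrightarrow>
     measure \<mu> A \<in> {0, 1})"

subsection \<open>The product measures\<close>

definition weight :: "(nat \<Rightarrow> nat \<Rightarrow> real) \<Rightarrow> nat \<Rightarrow> real" where
  "weight b k = (\<Prod>i<k. b 1 i / b (i + 1) 0)"

definition partition_fun :: "(nat \<Rightarrow> nat \<Rightarrow> real) \<Rightarrow> real \<Rightarrow> real" where
  "partition_fun b l = (\<Sum>k. weight b k * l ^ k)"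

definition lambda_star :: "(nat \<Rightarrow> nat \<Rightarrow> real) \<Rightarrow> ereal" where
  "lambda_star b = liminf (\<lambda>j. ereal (b (j + 1) 0 / b 1 j))"

definition site_measure :: "(nat \<Rightarrow> nat \<Rightarrow> real) \<Rightarrow> real \<Rightarrow> nat measure" where
  "site_measure b l =
     point_measure UNIV (\<lambda>n. ennreal (weight b n * l ^ n / partition_fun b l))"

definition product_measure :: "(nat \<Rightarrow> nat \<Rightarrow> real) \<Rightarrow> (nat \<Rightarrow> real) \<Rightarrow> config measure" where
  "product_measure b lam = PiM UNIV (\<lambda>x. site_measure b (lam x))"

end

theory Submission
  imports Defs
begin

text \<open>
  The example is a system on the half line in which the total jump rate of all sites together is
  finite, so that only finitely many particles move in finite time, while the stationary product
  measure is almost surely a finite perturbation of one deterministic configuration.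

  Let \<open>b i j = 2\<^bsup>-j\<^sup>2\<^esup>\<close> for \<open>i \<ge> 1\<close>, let \<open>p x (x + 1) = 2\<^bsup>-x\<^esup>\<close> and \<open>p (x + 1) x = 8\<^bsup>-x\<^esup>\<close>, and let
  \<open>\<lambda> x = 2\<^bsup>x(x - 1)\<^esup>\<close>. The ratio of the probabilities of \<open>n + 1\<close> and \<open>n\<close> particles at site \<open>x\<close> is
  \<open>\<lambda> x * 2\<^bsup>-n\<^sup>2\<^esup>\<close>, which is at least \<open>2\<^bsup>x - 1\<^esup>\<close> for \<open>n < x\<close> and at most \<open>2\<^bsup>-x\<^esup>\<close> for \<open>n \<ge> x\<close>. Hence site \<open>x\<close> has
  exactly \<open>x\<close> particles except with probability at most \<open>3 * 2\<^bsup>-x\<^esup>\<close> (\<open>marginal_concentration\<close>), and by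
  Borel--Cantelli almost surely \<open>\<eta> x = x\<close> for all large \<open>x\<close> (\<open>AE_eventually_coordinate\<close>). So there
  are infinitely many particles, and yet the number \<open>\<Sum>x. (\<eta> x - x)\<close> of particles relative to the
  deterministic profile is finite. Jumps preserve it. The event that it is even is invariant, and
  its probability is neither 0 nor 1 because adding a particle at site \<open>0\<close> exchanges it with the
  event that it is odd (\<open>measure_parity_set\<close>).

  Since \<open>p\<close> is summable, the generator is a bounded operator and the semigroup is an operator
  exponential (\<open>generates_semigroup\<close>). Stationarity comes from detailed balance,
  \<open>\<lambda> x * p x y = \<lambda> y * p y x\<close> (\<open>nn_integral_reversible\<close>). The same computation works on any set \<open>A\<close> that is
  invariant under jumps, so that the restrictions of the measure to \<open>A\<close> and to its complement are
  stationary as well. Together with the Jensen inequality \<open>(S t f)\<^sup>2 \<le> S t (f\<^sup>2)\<close> this shows that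
  \<open>S t F\<close> is no farther from the indicator of \<open>A\<close> in L2 than \<open>F\<close> is (\<open>semigroup_L2_contraction\<close>).
  Applied to a sequence of local functions converging to the indicator, it shows that the extension
  of \<open>S t\<close> to L2 fixes the indicator (\<open>L2_extension_invariant\<close>).
\<close>

section \<open>Exponentials of bounded operators\<close>

definition opexp :: "('a::real_normed_vector \<Rightarrow> 'a) \<Rightarrow> real \<Rightarrow> 'a \<Rightarrow> 'a" where
  "opexp Q t f = (\<Sum>n. (t ^ n / fact n) *\<^sub>R (Q ^^ n) f)"

lemma bounded_linear_funpow:
  fixes Q :: "'a::real_normed_vector \<Rightarrow> 'a"
  assumes "bounded_linear Q"
  shows "bounded_linear (Q ^^ n)"
proof (induction n)
  case 0
  show ?case by (simp add: id_def bounded_linear_ident)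
next
  case (Suc n)
  show ?case using bounded_linear_compose[OF assms Suc] by (simp add: comp_def)
qed

lemma norm_funpow_bound:
  fixes Q :: "'a::real_normed_vector \<Rightarrow> 'a"
  assumes "bounded_linear Q"
  obtains K where "K > 0" "\<And>n f. norm ((Q ^^ n) f) \<le> K ^ n * norm f"
proof -
  obtain K where K: "K > 0" "\<And>f. norm (Q f) \<le> norm f * K"
    using bounded_linear.pos_bounded[OF assms] by blast
  have "norm ((Q ^^ n) f) \<le> K ^ n * norm f" for n f
  proof (induction n)
    case (Suc n)
    have "norm ((Q ^^ Suc n) f) \<le> norm ((Q ^^ n) f) * K" using K(2) by simp
    also have "\<dots> \<le> K ^ n * norm f * K" using Suc K(1) by (intro mult_right_mono) auto
    finally show ?case by (simp add: mult_ac)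
  qed simp
  then show thesis using that K(1) by blast
qed

lemma summable_exp_real: "summable (\<lambda>n. (x::real) ^ n / fact n)"
  using summable_exp[of x] by (simp add: field_simps)

lemma sums_drop_two:
  fixes x :: "nat \<Rightarrow> 'b::real_normed_vector"
  assumes "x sums X"
  shows "(\<lambda>n. x (n + 2)) sums (X - x 0 - x 1)"
  using sums_split_initial_segment[OF assms, of 2] by (simp add: numeral_2_eq_2 diff_diff_add)

context
  fixes Q :: "'a::banach \<Rightarrow> 'a"
  assumes Q: "bounded_linear Q"
begin

lemma opexp_abs_summable: "summable (\<lambda>n. norm ((t ^ n / fact n) *\<^sub>R (Q ^^ n) f))"
proof -
  obtain K where K: "K > 0" "\<And>n f. norm ((Q ^^ n) f) \<le> K ^ n * norm f"
    using norm_funpow_bound[OF Q] by blast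
  show ?thesis
  proof (rule summable_comparison_test')
    show "summable (\<lambda>n. (\<bar>t\<bar> * K) ^ n / fact n * norm f)"
      by (intro summable_mult2 summable_exp_real)
    show "norm (norm ((t ^ n / fact n) *\<^sub>R (Q ^^ n) f)) \<le> (\<bar>t\<bar> * K) ^ n / fact n * norm f"
      for n
      using mult_left_mono[OF K(2)[of n f], of "\<bar>t\<bar> ^ n / fact n"]
      by (simp add: power_abs power_mult_distrib mult_ac)
  qed
qed

lemma opexp_sums: "(\<lambda>n. (t ^ n / fact n) *\<^sub>R (Q ^^ n) f) sums opexp Q t f"
  unfolding opexp_def by (rule summable_sums[OF summable_norm_cancel[OF opexp_abs_summable]])

lemma opexp_has_sum: "((\<lambda>n. (t ^ n / fact n) *\<^sub>R (Q ^^ n) f) has_sum opexp Q t f) UNIV"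
  by (rule norm_summable_imp_has_sum[OF opexp_abs_summable opexp_sums])

lemma opexp_add: "opexp Q t (f + g) = opexp Q t f + opexp Q t g"
proof -
  have "(\<lambda>n. (t ^ n / fact n) *\<^sub>R (Q ^^ n) (f + g)) sums (opexp Q t f + opexp Q t g)"
    using sums_add[OF opexp_sums opexp_sums]
    by (simp add: linear_add[OF bounded_linear.linear[OF bounded_linear_funpow[OF Q]]] scaleR_add_right)
  then show ?thesis using opexp_sums sums_unique2 by blast
qed

lemma opexp_scaleR: "opexp Q t (c *\<^sub>R f) = c *\<^sub>R opexp Q t f"
proof -
  have "(\<lambda>n. (t ^ n / fact n) *\<^sub>R (Q ^^ n) (c *\<^sub>R f)) sums (c *\<^sub>R opexp Q t f)"
    using sums_scaleR_right[OF opexp_sums, of c]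
    by (simp add: linear_scale[OF bounded_linear.linear[OF bounded_linear_funpow[OF Q]]] mult_ac)
  then show ?thesis using opexp_sums sums_unique2 by blast
qed

lemma opexp_0: "opexp Q 0 f = f"
proof -
  have "(\<lambda>n. (0 ^ n / fact n) *\<^sub>R (Q ^^ n) f) sums (\<Sum>n\<in>{0}. (0 ^ n / fact n) *\<^sub>R (Q ^^ n) f)"
    by (rule sums_finite) auto
  then show ?thesis using opexp_sums[of 0 f] sums_unique2 by fastforce
qed

lemma opexp_eigenvector:
  assumes "Q f = c *\<^sub>R f"
  shows "opexp Q t f = exp (t * c) *\<^sub>R f"
proof -
  have pow: "(Q ^^ n) f = c ^ n *\<^sub>R f" for n
    by (induction n) (simp_all add: linear_scale[OF bounded_linear.linear[OF Q]] assms mult_ac)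
  have "(\<lambda>n. ((t * c) ^ n /\<^sub>R fact n) *\<^sub>R f) sums (exp (t * c) *\<^sub>R f)"
    by (intro sums_scaleR_left exp_converges)
  then have "(\<lambda>n. (t ^ n / fact n) *\<^sub>R (Q ^^ n) f) sums (exp (t * c) *\<^sub>R f)"
    by (simp add: pow power_mult_distrib field_simps)
  then show ?thesis using opexp_sums sums_unique2 by blast
qed

text \<open>The dual form of the previous lemma. It turns an identity for the generator, tested against
  a measure, into invariance of that measure under the semigroup.\<close>

lemma opexp_eigenfunctional:
  fixes l :: "'a \<Rightarrow> real"
  assumes l: "bounded_linear l" and ev: "\<And>f. l (Q f) = c * l f"
  shows "l (opexp Q t f) = exp (t * c) * l f"
proof -
  have pow: "l ((Q ^^ n) f) = c ^ n * l f" for n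
    by (induction n) (simp_all add: ev mult_ac)
  have "(\<lambda>n. l ((t ^ n / fact n) *\<^sub>R (Q ^^ n) f)) sums l (opexp Q t f)"
    by (rule bounded_linear.sums[OF l opexp_sums])
  moreover have "(\<lambda>n. ((t * c) ^ n /\<^sub>R fact n) * l f) sums (exp (t * c) * l f)"
    by (intro sums_mult2 exp_converges)
  ultimately show ?thesis
    by (simp add: pow linear_scale[OF bounded_linear.linear[OF l]] power_mult_distrib field_simps
        sums_unique2)
qed

text \<open>All coefficients of the exponential series are nonnegative for \<open>t \<ge> 0\<close>, so every closed
  convex cone that is preserved by \<open>Q\<close> is preserved by its exponentials. This applies both to
  closed subspaces and to the cone of nonnegative functions.\<close>

lemma opexp_closed_cone:
  assumes "closed C" "0 \<in> C" and add: "\<And>f g. f \<in> C \<Longrightarrow> g \<in> C \<Longrightarrow> f + g \<in> C"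
    and scale: "\<And>c f. 0 \<le> c \<Longrightarrow> f \<in> C \<Longrightarrow> c *\<^sub>R f \<in> C"
    and QC: "\<And>f. f \<in> C \<Longrightarrow> Q f \<in> C" and "t \<ge> 0" "f \<in> C"
  shows "opexp Q t f \<in> C"
proof -
  have pow: "(Q ^^ n) f \<in> C" for n by (induction n) (simp_all add: QC \<open>f \<in> C\<close>)
  have "(\<Sum>i<n. (t ^ i / fact i) *\<^sub>R (Q ^^ i) f) \<in> C" for n
    by (induction n) (auto intro!: add scale simp: \<open>0 \<in> C\<close> pow \<open>t \<ge> 0\<close>)
  then show ?thesis
    using closed_sequentially[OF \<open>closed C\<close> _ opexp_sums[unfolded sums_def]] by simp
qed

text \<open>The double series of the composition converges absolutely, so it can be summed along the
  diagonals, where the binomial theorem gives the coefficients of the exponential of \<open>s + t\<close>.\<close>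

lemma opexp_semigroup: "opexp Q (s + t) f = opexp Q s (opexp Q t f)"
proof -
  obtain K where K: "K > 0" "\<And>n f. norm ((Q ^^ n) f) \<le> K ^ n * norm f"
    using norm_funpow_bound[OF Q] by blast
  define F where "F n m = (s ^ n / fact n * (t ^ m / fact m)) *\<^sub>R (Q ^^ (n + m)) f" for n m
  define a where "a r n = (\<bar>r\<bar> * K) ^ n / fact n" for r :: real and n :: nat
  have a_summable: "a r summable_on UNIV" for r
    unfolding a_def using K(1)
    by (subst summable_on_UNIV_nonneg_real_iff) (auto intro: summable_exp_real)
  have a_nonneg: "a r n \<ge> 0" for r n unfolding a_def using K(1) by simp
  have "(\<lambda>x. norm (case x of (n, m) \<Rightarrow> a s n * (a t m * norm f))) summable_on (UNIV \<times> UNIV)"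
    by (rule Infinite_Sum.abs_summable_on_Sigma_iff[THEN iffD2])
      (auto simp: a_nonneg infsum_cmult_right' abs_mult intro!: summable_on_cmult_right summable_on_cmult_left a_summable)
  then have "(\<lambda>x. norm (case x of (n, m) \<Rightarrow> F n m)) summable_on (UNIV \<times> UNIV)"
  proof (rule Infinite_Sum.abs_summable_on_comparison_test)
    fix x :: "nat \<times> nat"
    obtain n m where x: "x = (n, m)" by force
    have "norm (F n m) \<le> \<bar>s\<bar> ^ n / fact n * (\<bar>t\<bar> ^ m / fact m) * (K ^ (n + m) * norm f)"
      unfolding F_def norm_scaleR
      by (intro mult_mono K) (auto simp: abs_mult power_abs)
    also have "\<dots> = a s n * (a t m * norm f)"
      by (simp add: a_def power_mult_distrib power_add)
    finally show "norm (case x of (n, m) \<Rightarrow> F n m) \<le>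
        norm (case x of (n, m) \<Rightarrow> a s n * (a t m * norm f))"
      using a_nonneg by (simp add: x)
  qed
  then have sF: "(\<lambda>(n, m). F n m) summable_on (UNIV \<times> UNIV)"
    by (rule abs_summable_summable)
  have inner: "(\<Sum>\<^sub>\<infinity>m. F n m) = (s ^ n / fact n) *\<^sub>R (Q ^^ n) (opexp Q t f)" for n
  proof -
    have "((\<lambda>m. (s ^ n / fact n) *\<^sub>R (Q ^^ n) ((t ^ m / fact m) *\<^sub>R (Q ^^ m) f)) has_sum
        (s ^ n / fact n) *\<^sub>R (Q ^^ n) (opexp Q t f)) UNIV"
      by (intro has_sum_scaleR has_sum_bounded_linear[OF bounded_linear_funpow[OF Q]] opexp_has_sum)
    then show ?thesis
      by (simp add: F_def infsumI linear_scale[OF bounded_linear.linear[OF bounded_linear_funpow[OF Q]]]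
          funpow_add)
  qed
  have bij: "bij_betw (\<lambda>(k, i). (i, k - i)) (SIGMA k:UNIV. {..k}) (UNIV \<times> UNIV :: (nat \<times> nat) set)"
    by (rule bij_betw_byWitness[where f' = "\<lambda>(n, m). (n + m, n)"]) auto
  have sF': "(\<lambda>(k, i). F i (k - i)) summable_on (SIGMA k:UNIV. {..k})"
    using summable_on_reindex_bij_betw[OF bij, of "\<lambda>(n, m). F n m"] sF
    by (simp add: case_prod_unfold)
  have diag: "(\<Sum>\<^sub>\<infinity>i\<in>{..k}. F i (k - i)) = ((s + t) ^ k / fact k) *\<^sub>R (Q ^^ k) f" for k
  proof -
    have "(\<Sum>\<^sub>\<infinity>i\<in>{..k}. F i (k - i)) = (\<Sum>i\<le>k. s ^ i / fact i * (t ^ (k - i) / fact (k - i))) *\<^sub>R (Q ^^ k) f"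
      unfolding F_def by (simp add: scaleR_left.sum)
    also have "(\<Sum>i\<le>k. s ^ i / fact i * (t ^ (k - i) / fact (k - i))) = (s + t) ^ k / fact k"
      unfolding binomial_ring sum_divide_distrib
      by (intro sum.cong refl) (simp add: binomial_fact)
    finally show ?thesis .
  qed
  have "opexp Q s (opexp Q t f) = (\<Sum>\<^sub>\<infinity>n. \<Sum>\<^sub>\<infinity>m. F n m)"
    unfolding inner by (rule infsumI[OF opexp_has_sum, symmetric])
  also have "\<dots> = infsum (\<lambda>(n, m). F n m) (UNIV \<times> UNIV)"
    using infsum_Sigma'_banach[OF sF] by simp
  also have "\<dots> = infsum (\<lambda>(k, i). F i (k - i)) (SIGMA k:UNIV. {..k})"
    using infsum_reindex_bij_betw[OF bij, of "\<lambda>(n, m). F n m"] by (simp add: case_prod_unfold)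
  also have "\<dots> = (\<Sum>\<^sub>\<infinity>k. \<Sum>\<^sub>\<infinity>i\<in>{..k}. F i (k - i))"
    using infsum_Sigma'_banach[OF sF'] by simp
  also have "\<dots> = opexp Q (s + t) f"
    unfolding diag by (rule infsumI[OF opexp_has_sum])
  finally show ?thesis by simp
qed

text \<open>The terms of order at least two are dominated by those of the scalar exponential of
  \<open>K t\<close>, where \<open>K\<close> bounds the norm of \<open>Q\<close>.\<close>

lemma opexp_derivative: "((\<lambda>t. (opexp Q t f - f) /\<^sub>R t) \<longlongrightarrow> Q f) (at_right 0)"
proof -
  obtain K where K: "K > 0" "\<And>n f. norm ((Q ^^ n) f) \<le> K ^ n * norm f"
    using norm_funpow_bound[OF Q] by blast
  have bound: "norm (opexp Q t f - f - t *\<^sub>R Q f) \<le> (exp (K * t) - 1 - K * t) * norm f"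
    if "t > 0" for t
  proof -
    have first_terms: "(t ^ 0 / fact 0) *\<^sub>R (Q ^^ 0) f = f" "(t ^ 1 / fact 1) *\<^sub>R (Q ^^ 1) f = t *\<^sub>R Q f"
      "(K * t) ^ 0 /\<^sub>R fact 0 = 1" "(K * t) ^ 1 /\<^sub>R fact 1 = K * t"
      by simp_all
    have 1: "(\<lambda>n. (t ^ (n + 2) / fact (n + 2)) *\<^sub>R (Q ^^ (n + 2)) f) sums (opexp Q t f - f - t *\<^sub>R Q f)"
      using sums_drop_two[OF opexp_sums[of t f]] unfolding first_terms .
    have 2: "(\<lambda>n. (K * t) ^ (n + 2) /\<^sub>R fact (n + 2) * norm f) sums ((exp (K * t) - 1 - K * t) * norm f)"
      using sums_mult2[OF sums_drop_two[OF exp_converges[of "K * t"]], of "norm f"] unfolding first_terms .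
    have le: "norm ((t ^ n / fact n) *\<^sub>R (Q ^^ n) f) \<le> (K * t) ^ n /\<^sub>R fact n * norm f" for n
      using mult_left_mono[OF K(2)[of n f], of "t ^ n / fact n"] \<open>t > 0\<close>
      by (simp add: power_mult_distrib divide_inverse mult_ac)
    show ?thesis
      using norm_suminf_le[OF le sums_summable[OF 2]]
      unfolding sums_unique[OF 1, symmetric] sums_unique[OF 2, symmetric] .
  qed
  have "((\<lambda>t. (exp (K * t) - 1 - K * t) / t * norm f) \<longlongrightarrow> (K - K) * norm f) (at_right 0)"
  proof (intro tendsto_mult tendsto_const)
    have "((\<lambda>t. exp (K * t)) has_real_derivative K) (at 0)"
      by (auto intro!: derivative_eq_intros)
    then have "((\<lambda>t. (exp (K * t) - 1) / t) \<longlongrightarrow> K) (at 0)"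
      by (simp add: has_field_derivative_iff)
    then have "((\<lambda>t. (exp (K * t) - 1) / t - K) \<longlongrightarrow> K - K) (at_right 0)"
      by (intro tendsto_diff tendsto_const) (simp add: filterlim_at_split)
    then show "((\<lambda>t. (exp (K * t) - 1 - K * t) / t) \<longlongrightarrow> K - K) (at_right 0)"
      by (rule Lim_transform_eventually)
        (auto simp: eventually_at_right_field diff_divide_distrib intro!: exI[of _ 1])
  qed
  then have lim: "((\<lambda>t. (exp (K * t) - 1 - K * t) / t * norm f) \<longlongrightarrow> 0) (at_right 0)" by simp
  have "((\<lambda>t. (opexp Q t f - f) /\<^sub>R t - Q f) \<longlongrightarrow> 0) (at_right 0)"
  proof (rule Lim_null_comparison[OF _ lim])
    show "\<forall>\<^sub>F t in at_right 0. norm ((opexp Q t f - f) /\<^sub>R t - Q f) \<le>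
        (exp (K * t) - 1 - K * t) / t * norm f"
    proof (rule eventually_at_rightI[of 0 1])
      fix t :: real assume "t \<in> {0<..<1}"
      then have t: "t > 0" by simp
      have "(opexp Q t f - f) /\<^sub>R t - Q f = (opexp Q t f - f - t *\<^sub>R Q f) /\<^sub>R t"
        using t by (simp add: scaleR_diff_right)
      then have "norm ((opexp Q t f - f) /\<^sub>R t - Q f) = norm (opexp Q t f - f - t *\<^sub>R Q f) / t"
        using t by (simp add: divide_inverse mult.commute)
      also have "\<dots> \<le> (exp (K * t) - 1 - K * t) * norm f / t"
        using bound[OF t] t by (intro divide_right_mono) auto
      finally show "norm ((opexp Q t f - f) /\<^sub>R t - Q f) \<le> (exp (K * t) - 1 - K * t) / t * norm f"
        by simp
    qed simp
  qed
  then show ?thesis by (rule LIM_zero_cancel)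
qed

end

section \<open>Bounded continuous functions on the configuration space\<close>

text \<open>Cylinders over finitely many coordinates are open because each coordinate is discrete.\<close>

lemma continuous_on_finite_dependence:
  fixes f :: "config \<Rightarrow> 'b::topological_space"
  assumes "finite J" and dep: "\<And>\<eta> \<zeta>. (\<And>j. j \<in> J \<Longrightarrow> \<eta> j = \<zeta> j) \<Longrightarrow> f \<eta> = f \<zeta>"
  shows "continuous_on UNIV f"
  unfolding continuous_on_open_vimage[OF open_UNIV]
proof (intro allI impI)
  fix B :: "'b set" assume "open B"
  show "open (f -` B \<inter> UNIV)"
  proof (subst open_subopen, intro ballI)
    fix \<eta> assume \<eta>: "\<eta> \<in> f -` B \<inter> UNIV"
    have "open (\<Inter>j\<in>J. (\<lambda>\<zeta>::config. \<zeta> j) -` {\<eta> j})"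
      by (intro open_INT \<open>finite J\<close> ballI open_vimage continuous_on_product_coordinates)
        (rule Topological_Spaces.open_discrete)
    moreover have "(\<Inter>j\<in>J. (\<lambda>\<zeta>. \<zeta> j) -` {\<eta> j}) \<subseteq> f -` B \<inter> UNIV"
    proof
      fix \<zeta> assume "\<zeta> \<in> (\<Inter>j\<in>J. (\<lambda>\<zeta>. \<zeta> j) -` {\<eta> j})"
      then have "f \<eta> = f \<zeta>" by (intro dep) simp
      then show "\<zeta> \<in> f -` B \<inter> UNIV" using \<eta> by simp
    qed
    ultimately show "\<exists>T. open T \<and> \<eta> \<in> T \<and> T \<subseteq> f -` B \<inter> UNIV" by auto
  qed
qed

lemma continuous_on_jump: "continuous_on UNIV (\<lambda>\<eta>. jump \<eta> x y)"
  by (intro continuous_on_coordinatewise_then_product continuous_on_finite_dependence[where J = "{_}"])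
    (auto simp: jump_def)

text \<open>With the usual distance on the natural numbers the configuration space is a countable product
  of metric spaces, hence metric, and its bounded continuous functions form a Banach space.\<close>

instantiation nat :: metric_space
begin

definition dist_nat :: "nat \<Rightarrow> nat \<Rightarrow> real" where
  "dist_nat m n = \<bar>real m - real n\<bar>"

definition uniformity_nat :: "(nat \<times> nat) filter" where
  "uniformity_nat = (INF e\<in>{0<..}. principal {(x, y). dist x y < e})"

instance
proof
  fix U :: "nat set" and l m n :: nat
  show "uniformity = (INF e\<in>{0<..}. principal {(x::nat, y). dist x y < e})"
    by (rule uniformity_nat_def)
  have close: "\<bar>real x - real y\<bar> < 1 \<Longrightarrow> x = y" for x y by linarith
  have "\<forall>\<^sub>F (x', y) in uniformity. x' = x \<longrightarrow> y \<in> U" if "x \<in> U" for x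
    unfolding uniformity_nat_def
    by (rule eventually_INF1[of 1]) (use that close in \<open>fastforce simp: eventually_principal dist_nat_def\<close>)+
  then show "open U \<longleftrightarrow> (\<forall>x\<in>U. \<forall>\<^sub>F (x', y) in uniformity. x' = x \<longrightarrow> y \<in> U)"
    using Topological_Spaces.open_discrete[of U] by blast
  show "dist m n = 0 \<longleftrightarrow> m = n" by (simp add: dist_nat_def)
  show "dist m n \<le> dist m l + dist n l" by (simp add: dist_nat_def)
qed

end

instance bcontfun :: (metric_space, banach) banach ..

lemma apply_Bcontfun:
  fixes f :: "'a::topological_space \<Rightarrow> real"
  assumes "continuous_on UNIV f" "\<And>x. \<bar>f x\<bar> \<le> K"
  shows "apply_bcontfun (Bcontfun f) = f"
  by (rule Bcontfun_inverse, rule bcontfun_normI[where b = K]) (use assms in auto)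

lemma bounded_linear_apply_bcontfun:
  "bounded_linear (\<lambda>f :: 'a::topological_space \<Rightarrow>\<^sub>C real. apply_bcontfun f x)"
  by (rule bounded_linear_intro[where K = 1]) (simp_all add: norm_bounded[where 'b = real, simplified])

lemma abs_apply_le_norm: "\<bar>apply_bcontfun f x\<bar> \<le> norm f" for f :: "'a::topological_space \<Rightarrow>\<^sub>C real"
  using norm_bounded[of f x] by simp

section \<open>The space of functions with summable oscillations\<close>

lemma diff_le_oscillation:
  fixes f :: "config \<Rightarrow>\<^sub>C real"
  assumes "\<And>j. j \<noteq> i \<Longrightarrow> \<eta> j = \<zeta> j"
  shows "\<bar>apply_bcontfun f \<eta> - apply_bcontfun f \<zeta>\<bar> \<le> oscillation (apply_bcontfun f) i"
  unfolding oscillation_def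
proof (rule cSup_upper)
  show "bdd_above {\<bar>apply_bcontfun f \<eta> - apply_bcontfun f \<zeta>\<bar> |\<eta> \<zeta>. \<forall>j. j \<noteq> i \<longrightarrow> \<eta> j = \<zeta> j}"
  proof (rule bdd_aboveI[where M = "2 * norm f"], clarify)
    fix \<eta> \<zeta> :: config
    show "\<bar>apply_bcontfun f \<eta> - apply_bcontfun f \<zeta>\<bar> \<le> 2 * norm f"
      using abs_apply_le_norm[of f \<eta>] abs_apply_le_norm[of f \<zeta>] by linarith
  qed
qed (use assms in auto)

lemma core_DI:
  fixes f :: "config \<Rightarrow>\<^sub>C real"
  assumes "summable a"
    and bound: "\<And>i \<eta> \<zeta>. (\<And>j. j \<noteq> i \<Longrightarrow> \<eta> j = \<zeta> j) \<Longrightarrow>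
      \<bar>apply_bcontfun f \<eta> - apply_bcontfun f \<zeta>\<bar> \<le> a i"
  shows "f \<in> core_D"
proof -
  have "norm (oscillation (apply_bcontfun f) i) \<le> a i" for i
  proof -
    have "oscillation (apply_bcontfun f) i \<le> a i"
      unfolding oscillation_def by (rule cSup_least) (use bound in auto)
    moreover have "0 \<le> oscillation (apply_bcontfun f) i"
      using diff_le_oscillation[of i "\<lambda>_. 0" "\<lambda>_. 0" f] by simp
    ultimately show ?thesis by simp
  qed
  then show ?thesis
    unfolding core_D_def using summable_comparison_test'[OF \<open>summable a\<close>] by blast
qed

text \<open>Finitely many coordinates do not matter for summability, since every oscillation of a bounded
  function is finite.\<close>

lemma core_DI_cofinite:
  fixes f :: "config \<Rightarrow>\<^sub>C real"
  assumes "finite J" "summable a"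
    and bound: "\<And>i \<eta> \<zeta>. i \<notin> J \<Longrightarrow> (\<And>j. j \<noteq> i \<Longrightarrow> \<eta> j = \<zeta> j) \<Longrightarrow>
      \<bar>apply_bcontfun f \<eta> - apply_bcontfun f \<zeta>\<bar> \<le> a i"
  shows "f \<in> core_D"
proof (rule core_DI)
  show "summable (\<lambda>i. (if i \<in> J then 2 * norm f - a i else 0) + a i)"
    by (intro summable_add summable_If_finite_set assms)
  fix i \<eta> \<zeta> assume eq: "\<And>j. j \<noteq> i \<Longrightarrow> \<eta> j = (\<zeta> :: config) j"
  show "\<bar>apply_bcontfun f \<eta> - apply_bcontfun f \<zeta>\<bar> \<le> (if i \<in> J then 2 * norm f - a i else 0) + a i"
    using bound[of i \<eta> \<zeta>] eq abs_apply_le_norm[of f \<eta>] abs_apply_le_norm[of f \<zeta>]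
    by (cases "i \<in> J") auto
qed

lemma core_D_finite_dependence:
  assumes "finite J" "\<And>\<eta> \<zeta>. (\<And>j. j \<in> J \<Longrightarrow> \<eta> j = \<zeta> j) \<Longrightarrow> apply_bcontfun f \<eta> = apply_bcontfun f \<zeta>"
  shows "f \<in> core_D"
proof (rule core_DI_cofinite[OF \<open>finite J\<close> summable_zero])
  fix i \<eta> \<zeta> assume "i \<notin> J" and eq: "\<And>j. j \<noteq> i \<Longrightarrow> \<eta> j = (\<zeta> :: config) j"
  then have "apply_bcontfun f \<eta> = apply_bcontfun f \<zeta>" by (intro assms(2)) metis
  then show "\<bar>apply_bcontfun f \<eta> - apply_bcontfun f \<zeta>\<bar> \<le> 0" by simp
qed

lemma core_D_add:
  assumes "f \<in> core_D" "g \<in> core_D"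
  shows "f + g \<in> core_D"
proof (rule core_DI)
  show "summable (\<lambda>i. oscillation (apply_bcontfun f) i + oscillation (apply_bcontfun g) i)"
    using assms by (intro summable_add) (simp_all add: core_D_def)
  fix i \<eta> \<zeta> assume eq: "\<And>j. j \<noteq> i \<Longrightarrow> \<eta> j = (\<zeta> :: config) j"
  show "\<bar>apply_bcontfun (f + g) \<eta> - apply_bcontfun (f + g) \<zeta>\<bar> \<le>
      oscillation (apply_bcontfun f) i + oscillation (apply_bcontfun g) i"
    using diff_le_oscillation[of i \<eta> \<zeta> f] diff_le_oscillation[of i \<eta> \<zeta> g] eq by fastforce
qed

lemma core_D_scaleR:
  assumes "f \<in> core_D"
  shows "c *\<^sub>R f \<in> core_D"
proof (rule core_DI)
  show "summable (\<lambda>i. \<bar>c\<bar> * oscillation (apply_bcontfun f) i)"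
    using assms by (intro summable_mult) (simp add: core_D_def)
  fix i \<eta> \<zeta> assume eq: "\<And>j. j \<noteq> i \<Longrightarrow> \<eta> j = (\<zeta> :: config) j"
  show "\<bar>apply_bcontfun (c *\<^sub>R f) \<eta> - apply_bcontfun (c *\<^sub>R f) \<zeta>\<bar> \<le>
      \<bar>c\<bar> * oscillation (apply_bcontfun f) i"
    using mult_left_mono[OF diff_le_oscillation[of i \<eta> \<zeta> f], of "\<bar>c\<bar>"] eq
    by (simp add: abs_mult[symmetric] right_diff_distrib)
qed

lemma subspace_core_D: "subspace core_D"
  unfolding subspace_def
  using core_D_add core_D_scaleR core_D_finite_dependence[of "{}" 0] by simp

lemma subspace_closure:
  fixes S :: "'a::real_normed_vector set"
  assumes "subspace S"
  shows "subspace (closure S)"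
proof (rule subspaceI)
  show "0 \<in> closure S" using assms closure_subset subspace_0 by blast
  fix x y assume "x \<in> closure S" "y \<in> closure S"
  then obtain u v where "\<forall>n. u n \<in> S" "u \<longlonglongrightarrow> x" "\<forall>n. v n \<in> S" "v \<longlonglongrightarrow> y"
    unfolding closure_sequential by blast
  then show "x + y \<in> closure S"
    unfolding closure_sequential using tendsto_add subspace_add[OF assms]
    by (intro exI[of _ "\<lambda>n. u n + v n"]) auto
next
  fix c x assume "x \<in> closure S"
  then obtain u where "\<forall>n. u n \<in> S" "u \<longlonglongrightarrow> x" unfolding closure_sequential by blast
  then show "c *\<^sub>R x \<in> closure S"
    unfolding closure_sequential using tendsto_scaleR[OF tendsto_const] subspace_scale[OF assms]
    by (intro exI[of _ "\<lambda>n. c *\<^sub>R u n"]) auto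
qed

lemma infsum_in_closed_subspace:
  fixes f :: "'b \<Rightarrow> 'a::real_normed_vector"
  assumes "subspace C" "closed C" "\<And>x. x \<in> A \<Longrightarrow> f x \<in> C"
  shows "infsum f A \<in> C"
proof (cases "f summable_on A")
  case True
  have "(sum f \<longlongrightarrow> infsum f A) (finite_subsets_at_top A)"
    using has_sum_infsum[OF True] unfolding has_sum_def .
  moreover have "\<forall>\<^sub>F F in finite_subsets_at_top A. sum f F \<in> C"
    using assms(3)
    by (intro eventually_finite_subsets_at_top_weakI subspace_sum[OF assms(1)]) auto
  ultimately show ?thesis
    by (intro Lim_in_closed_set[OF \<open>closed C\<close> _ finite_subsets_at_top_neq_bot])
next
  case False
  then show ?thesis using assms(1) by (simp add: infsum_not_exists subspace_0)
qed

section \<open>The semigroup for a summable jump kernel\<close>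

text \<open>The total jump rate of the whole system is finite. Therefore the generator is a bounded
  operator on all bounded continuous functions, and the semigroup is its exponential.\<close>

locale summable_kernel =
  fixes b p :: "nat \<Rightarrow> nat \<Rightarrow> real"
  assumes p_nonneg: "0 \<le> p x y"
    and p_summable: "(\<lambda>(x, y). p x y) summable_on UNIV"
    and b_nonneg: "0 \<le> b i j"
    and b_le_1: "b i j \<le> 1"
begin

definition gain :: "nat \<Rightarrow> nat \<Rightarrow> (config \<Rightarrow>\<^sub>C real) \<Rightarrow> config \<Rightarrow>\<^sub>C real" where
  "gain x y f = Bcontfun (\<lambda>\<eta>. b (\<eta> x) (\<eta> y) * apply_bcontfun f (jump \<eta> x y))"

definition loss :: "nat \<Rightarrow> nat \<Rightarrow> (config \<Rightarrow>\<^sub>C real) \<Rightarrow> config \<Rightarrow>\<^sub>C real" where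
  "loss x y f = Bcontfun (\<lambda>\<eta>. b (\<eta> x) (\<eta> y) * apply_bcontfun f \<eta>)"

definition gen :: "(config \<Rightarrow>\<^sub>C real) \<Rightarrow> config \<Rightarrow>\<^sub>C real" where
  "gen f = (\<Sum>\<^sub>\<infinity>(x, y)\<in>UNIV. p x y *\<^sub>R (gain x y f - loss x y f))"

definition total_rate :: real where
  "total_rate = (\<Sum>\<^sub>\<infinity>(x, y)\<in>UNIV. p x y)"

text \<open>Adding the total rate makes the operator positive, since \<open>1 - b\<close> is then the
  weight of staying at the old configuration. The exponential of this positive operator differs from
  that of the generator only by a scalar factor.\<close>

definition shifted_gen :: "(config \<Rightarrow>\<^sub>C real) \<Rightarrow> config \<Rightarrow>\<^sub>C real" where
  "shifted_gen f = gen f + total_rate *\<^sub>R f"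

definition semigroup :: "real \<Rightarrow> (config \<Rightarrow>\<^sub>C real) \<Rightarrow> config \<Rightarrow>\<^sub>C real" where
  "semigroup t f = exp (- (t * total_rate)) *\<^sub>R opexp shifted_gen t f"

lemma b_times_bound: "\<bar>r\<bar> \<le> K \<Longrightarrow> \<bar>b i j * r\<bar> \<le> K"
  using mult_mono[OF b_le_1[of i j], of "\<bar>r\<bar>" K] b_nonneg[of i j] by (simp add: abs_mult)

lemma apply_gain: "apply_bcontfun (gain x y f) \<eta> = b (\<eta> x) (\<eta> y) * apply_bcontfun f (jump \<eta> x y)"
proof -
  have "apply_bcontfun (gain x y f) = (\<lambda>\<eta>. b (\<eta> x) (\<eta> y) * apply_bcontfun f (jump \<eta> x y))"
    unfolding gain_def
  proof (rule apply_Bcontfun)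
    show "continuous_on UNIV (\<lambda>\<eta>. b (\<eta> x) (\<eta> y) * apply_bcontfun f (jump \<eta> x y))"
      by (intro continuous_on_mult continuous_on_compose2[OF continuous_on_apply_bcontfun]
          continuous_on_jump continuous_on_finite_dependence[where J = "{x, y}"]) auto
  qed (rule b_times_bound, rule abs_apply_le_norm)
  then show ?thesis by simp
qed

lemma apply_loss: "apply_bcontfun (loss x y f) \<eta> = b (\<eta> x) (\<eta> y) * apply_bcontfun f \<eta>"
proof -
  have "apply_bcontfun (loss x y f) = (\<lambda>\<eta>. b (\<eta> x) (\<eta> y) * apply_bcontfun f \<eta>)"
    unfolding loss_def
  proof (rule apply_Bcontfun)
    show "continuous_on UNIV (\<lambda>\<eta>. b (\<eta> x) (\<eta> y) * apply_bcontfun f \<eta>)"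
      by (intro continuous_on_mult continuous_on_apply_bcontfun
          continuous_on_finite_dependence[where J = "{x, y}"]) auto
  qed (rule b_times_bound, rule abs_apply_le_norm)
  then show ?thesis by simp
qed

lemma gain_loss_linear:
  "gain x y (f + g) = gain x y f + gain x y g" "loss x y (f + g) = loss x y f + loss x y g"
  "gain x y (c *\<^sub>R f) = c *\<^sub>R gain x y f" "loss x y (c *\<^sub>R f) = c *\<^sub>R loss x y f"
  by (auto intro!: bcontfun_eqI simp: apply_gain apply_loss algebra_simps)

lemma norm_gain_le: "norm (gain x y f) \<le> norm f" and norm_loss_le: "norm (loss x y f) \<le> norm f"
  by (rule norm_bound; simp add: apply_gain apply_loss b_times_bound abs_apply_le_norm)+

lemma abs_summable_weighted:
  fixes u :: "nat \<Rightarrow> nat \<Rightarrow> 'a::real_normed_vector"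
  assumes "\<And>x y. norm (u x y) \<le> K"
  shows "(\<lambda>z. norm (case z of (x, y) \<Rightarrow> p x y *\<^sub>R u x y)) summable_on UNIV"
proof (rule Infinite_Sum.abs_summable_on_comparison_test')
  show "(\<lambda>z. (case z of (x, y) \<Rightarrow> p x y) * K) summable_on UNIV"
    by (intro summable_on_cmult_left p_summable)
  show "norm (case z of (x, y) \<Rightarrow> p x y *\<^sub>R u x y) \<le> (case z of (x, y) \<Rightarrow> p x y) * K" for z
    using assms p_nonneg by (auto split: prod.split intro: mult_left_mono)
qed

lemma summable_weighted:
  fixes u :: "nat \<Rightarrow> nat \<Rightarrow> 'a::banach"
  assumes "\<And>x y. norm (u x y) \<le> K"
  shows "(\<lambda>(x, y). p x y *\<^sub>R u x y) summable_on UNIV"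
  using abs_summable_weighted[OF assms] by (rule abs_summable_summable)

lemma norm_gain_minus_loss_le: "norm (gain x y f - loss x y f) \<le> 2 * norm f"
  using norm_triangle_ineq4[of "gain x y f" "loss x y f"] norm_gain_le[of x y f] norm_loss_le[of x y f]
  by simp

lemma gen_summable: "(\<lambda>(x, y). p x y *\<^sub>R (gain x y f - loss x y f)) summable_on UNIV"
  by (rule summable_weighted[OF norm_gain_minus_loss_le])

lemma bounded_linear_gen_sum:
  fixes l :: "(config \<Rightarrow>\<^sub>C real) \<Rightarrow> real"
  assumes "bounded_linear l"
  shows "l (gen f) = (\<Sum>\<^sub>\<infinity>(x, y)\<in>UNIV. p x y * l (gain x y f - loss x y f))"
proof -
  have "((\<lambda>z. l (case z of (x, y) \<Rightarrow> p x y *\<^sub>R (gain x y f - loss x y f))) has_sum l (gen f)) UNIV"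
    unfolding gen_def using has_sum_infsum[OF gen_summable] by (rule has_sum_bounded_linear[OF assms])
  then have "l (gen f) = (\<Sum>\<^sub>\<infinity>z. l (case z of (x, y) \<Rightarrow> p x y *\<^sub>R (gain x y f - loss x y f)))"
    by (simp add: infsumI)
  then show ?thesis
    by (simp add: case_prod_unfold linear_scale[OF bounded_linear.linear[OF assms]])
qed

lemma apply_gen: "apply_bcontfun (gen f) = generator_L b p (apply_bcontfun f)"
proof
  fix \<eta>
  show "apply_bcontfun (gen f) \<eta> = generator_L b p (apply_bcontfun f) \<eta>"
    unfolding bounded_linear_gen_sum[OF bounded_linear_apply_bcontfun] generator_L_def
    by (simp add: apply_gain apply_loss algebra_simps)
qed

lemma bounded_linear_gen: "bounded_linear gen"
proof (rule bounded_linear_intro)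
  fix f g c
  have "gen (f + g) = (\<Sum>\<^sub>\<infinity>z\<in>UNIV. (case z of (x, y) \<Rightarrow> p x y *\<^sub>R (gain x y f - loss x y f)) +
      (case z of (x, y) \<Rightarrow> p x y *\<^sub>R (gain x y g - loss x y g)))"
    unfolding gen_def
    by (rule infsum_cong) (auto simp: gain_loss_linear algebra_simps split: prod.split)
  then show "gen (f + g) = gen f + gen g"
    unfolding gen_def by (subst (asm) infsum_add[OF gen_summable gen_summable])
  have "gen (c *\<^sub>R f) = (\<Sum>\<^sub>\<infinity>z\<in>UNIV. c *\<^sub>R (case z of (x, y) \<Rightarrow> p x y *\<^sub>R (gain x y f - loss x y f)))"
    unfolding gen_def
    by (rule infsum_cong) (auto simp: gain_loss_linear algebra_simps split: prod.split)
  then show "gen (c *\<^sub>R f) = c *\<^sub>R gen f"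
    unfolding gen_def infsum_scaleR_right .
  have "norm (gen f) \<le> (\<Sum>\<^sub>\<infinity>z. norm (case z of (x, y) \<Rightarrow> p x y *\<^sub>R (gain x y f - loss x y f)))"
    unfolding gen_def by (rule norm_infsum_bound[OF abs_summable_weighted[OF norm_gain_minus_loss_le]])
  also have "\<dots> \<le> (\<Sum>\<^sub>\<infinity>z. (case z of (x, y) \<Rightarrow> p x y) * (2 * norm f))"
    using p_nonneg norm_gain_minus_loss_le
    by (intro infsum_mono abs_summable_weighted[OF norm_gain_minus_loss_le]
        summable_on_cmult_left p_summable) (auto split: prod.split intro: mult_left_mono)
  also have "\<dots> = norm f * (2 * total_rate)"
    unfolding total_rate_def by (simp add: infsum_cmult_left')
  finally show "norm (gen f) \<le> norm f * (2 * total_rate)" .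
qed

lemma bounded_linear_shifted_gen: "bounded_linear shifted_gen"
  unfolding shifted_gen_def
  by (intro bounded_linear_add bounded_linear_gen bounded_linear_scaleR_right)

lemma gain_core_D:
  assumes "f \<in> core_D"
  shows "gain x y f \<in> core_D"
proof (rule core_DI_cofinite[where J = "{x, y}"])
  show "summable (oscillation (apply_bcontfun f))" using assms by (simp add: core_D_def)
  fix i \<eta> \<zeta> assume i: "i \<notin> {x, y}" and eq: "\<And>j. j \<noteq> i \<Longrightarrow> \<eta> j = (\<zeta> :: config) j"
  have xy: "\<eta> x = \<zeta> x" "\<eta> y = \<zeta> y" using eq i by auto
  have "jump \<eta> x y j = jump \<zeta> x y j" if "j \<noteq> i" for j
    using eq[OF that] by (simp add: jump_def)
  then have "\<bar>apply_bcontfun f (jump \<eta> x y) - apply_bcontfun f (jump \<zeta> x y)\<bar> \<le>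
      oscillation (apply_bcontfun f) i"
    by (rule diff_le_oscillation)
  then show "\<bar>apply_bcontfun (gain x y f) \<eta> - apply_bcontfun (gain x y f) \<zeta>\<bar> \<le>
      oscillation (apply_bcontfun f) i"
    using b_times_bound by (simp add: apply_gain xy flip: right_diff_distrib)
qed simp

lemma loss_core_D:
  assumes "f \<in> core_D"
  shows "loss x y f \<in> core_D"
proof (rule core_DI_cofinite[where J = "{x, y}"])
  show "summable (oscillation (apply_bcontfun f))" using assms by (simp add: core_D_def)
  fix i \<eta> \<zeta> assume i: "i \<notin> {x, y}" and eq: "\<And>j. j \<noteq> i \<Longrightarrow> \<eta> j = (\<zeta> :: config) j"
  have xy: "\<eta> x = \<zeta> x" "\<eta> y = \<zeta> y" using eq i by auto
  have "\<bar>apply_bcontfun f \<eta> - apply_bcontfun f \<zeta>\<bar> \<le> oscillation (apply_bcontfun f) i"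
    using eq by (rule diff_le_oscillation)
  then show "\<bar>apply_bcontfun (loss x y f) \<eta> - apply_bcontfun (loss x y f) \<zeta>\<bar> \<le>
      oscillation (apply_bcontfun f) i"
    using b_times_bound by (simp add: apply_loss xy flip: right_diff_distrib)
qed simp

text \<open>Each bond term maps \<^const>\<open>core_D\<close> to itself. The infinite sum over the bonds only stays in
  the closure, which is the space on which the semigroup has to act.\<close>

lemma gen_closure_core_D:
  assumes f: "f \<in> closure core_D"
  shows "gen f \<in> closure core_D"
proof -
  have "gen ` core_D \<subseteq> closure core_D"
  proof clarify
    fix g assume g: "g \<in> core_D"
    show "gen g \<in> closure core_D"
      unfolding gen_def
    proof (rule infsum_in_closed_subspace[OF subspace_closure[OF subspace_core_D] closed_closure])
      show "(case z of (x, y) \<Rightarrow> p x y *\<^sub>R (gain x y g - loss x y g)) \<in> closure core_D" for z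
        using subspace_scale[OF subspace_core_D subspace_diff[OF subspace_core_D gain_core_D[OF g] loss_core_D[OF g]]]
          closure_subset[of core_D] by (auto split: prod.split)
    qed
  qed
  then show ?thesis
    using image_closure_subset[OF linear_continuous_on[OF bounded_linear_gen] closed_closure] f by blast
qed

lemma shifted_gen_closure_core_D: "f \<in> closure core_D \<Longrightarrow> shifted_gen f \<in> closure core_D"
  unfolding shifted_gen_def
  by (intro subspace_add[OF subspace_closure[OF subspace_core_D]] gen_closure_core_D
      subspace_scale[OF subspace_closure[OF subspace_core_D]])

lemma shifted_gen_nonneg:
  assumes "\<And>\<eta>. 0 \<le> apply_bcontfun f \<eta>"
  shows "0 \<le> apply_bcontfun (shifted_gen f) \<eta>"
proof -
  let ?u = "\<lambda>x y. apply_bcontfun (gain x y f - loss x y f) \<eta>"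
  have s: "(\<lambda>(x, y). p x y *\<^sub>R ?u x y) summable_on UNIV"
    by (rule summable_weighted[where K = "2 * norm f"])
      (use order_trans[OF norm_bounded norm_gain_minus_loss_le] in blast)
  have s': "(\<lambda>z. (case z of (x, y) \<Rightarrow> p x y) * apply_bcontfun f \<eta>) summable_on UNIV"
    by (intro summable_on_cmult_left p_summable)
  have "apply_bcontfun (shifted_gen f) \<eta> = (\<Sum>\<^sub>\<infinity>(x, y)\<in>UNIV. p x y *\<^sub>R ?u x y) +
      (\<Sum>\<^sub>\<infinity>z\<in>UNIV. (case z of (x, y) \<Rightarrow> p x y) * apply_bcontfun f \<eta>)"
    unfolding infsum_cmult_left' total_rate_def[symmetric]
    using bounded_linear_gen_sum[OF bounded_linear_apply_bcontfun, of f \<eta>]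
    by (simp add: shifted_gen_def)
  also have "\<dots> = (\<Sum>\<^sub>\<infinity>z. (case z of (x, y) \<Rightarrow> p x y *\<^sub>R ?u x y) +
      (case z of (x, y) \<Rightarrow> p x y) * apply_bcontfun f \<eta>)"
    by (rule infsum_add[OF s s', symmetric])
  also have "\<dots> \<ge> 0"
  proof (rule infsum_nonneg)
    fix z :: "nat \<times> nat"
    obtain x y where z: "z = (x, y)" by force
    have "0 \<le> p x y * (b (\<eta> x) (\<eta> y) * apply_bcontfun f (jump \<eta> x y) +
        (1 - b (\<eta> x) (\<eta> y)) * apply_bcontfun f \<eta>)"
      using assms p_nonneg b_nonneg b_le_1 by (intro mult_nonneg_nonneg add_nonneg_nonneg) auto
    then show "0 \<le> (case z of (x, y) \<Rightarrow> p x y *\<^sub>R ?u x y) + (case z of (x, y) \<Rightarrow> p x y) * apply_bcontfun f \<eta>"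
      by (simp add: z apply_gain apply_loss algebra_simps)
  qed
  finally show ?thesis .
qed

lemma gen_const: "gen (const_bcontfun c) = 0"
proof (rule bcontfun_eqI)
  show "apply_bcontfun (gen (const_bcontfun c)) \<eta> = apply_bcontfun 0 \<eta>" for \<eta>
    unfolding apply_gen by (simp add: generator_L_def case_prod_unfold)
qed

lemma semigroup_add: "semigroup t (f + g) = semigroup t f + semigroup t g"
  by (simp add: semigroup_def opexp_add[OF bounded_linear_shifted_gen] scaleR_add_right)

lemma semigroup_scaleR: "semigroup t (c *\<^sub>R f) = c *\<^sub>R semigroup t f"
  by (simp add: semigroup_def opexp_scaleR[OF bounded_linear_shifted_gen] mult_ac)

lemma semigroup_diff: "semigroup t (f - g) = semigroup t f - semigroup t g"
  using semigroup_add[of t f "(-1) *\<^sub>R g"] semigroup_scaleR[of t "-1" g] by simp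

lemma semigroup_const: "semigroup t (const_bcontfun c) = const_bcontfun c"
proof -
  have "opexp shifted_gen t (const_bcontfun c) = exp (t * total_rate) *\<^sub>R const_bcontfun c"
    by (rule opexp_eigenvector[OF bounded_linear_shifted_gen])
      (simp add: shifted_gen_def gen_const)
  then show ?thesis by (simp add: semigroup_def exp_minus_inverse flip: exp_add)
qed

lemma semigroup_nonneg:
  assumes "t \<ge> 0" "\<And>\<eta>. 0 \<le> apply_bcontfun f \<eta>"
  shows "0 \<le> apply_bcontfun (semigroup t f) \<eta>"
proof -
  let ?C = "{f :: config \<Rightarrow>\<^sub>C real. \<forall>\<eta>. 0 \<le> apply_bcontfun f \<eta>}"
  have "closed ?C"
    by (intro closed_Collect_all closed_Collect_le continuous_on_const
        linear_continuous_on[OF bounded_linear_apply_bcontfun])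
  then have "opexp shifted_gen t f \<in> ?C"
    by (rule opexp_closed_cone[OF bounded_linear_shifted_gen])
      (use assms shifted_gen_nonneg in auto)
  then show ?thesis by (simp add: semigroup_def)
qed

lemma semigroup_closure_core_D:
  assumes "t \<ge> 0" "f \<in> closure core_D"
  shows "semigroup t f \<in> closure core_D"
proof -
  note sub = subspace_closure[OF subspace_core_D]
  have "opexp shifted_gen t f \<in> closure core_D"
    by (rule opexp_closed_cone[OF bounded_linear_shifted_gen closed_closure])
      (use assms shifted_gen_closure_core_D subspace_0[OF sub] subspace_add[OF sub]
        subspace_scale[OF sub] in auto)
  then show ?thesis unfolding semigroup_def by (rule subspace_scale[OF sub])
qed

lemma semigroup_derivative: "((\<lambda>t. (semigroup t f - f) /\<^sub>R t) \<longlongrightarrow> gen f) (at_right 0)"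
proof -
  have "((\<lambda>t. exp (- (t * total_rate))) has_real_derivative - total_rate) (at 0)"
    by (auto intro!: derivative_eq_intros)
  then have "((\<lambda>t. (exp (- (t * total_rate)) - 1) / t) \<longlongrightarrow> - total_rate) (at 0)"
    by (simp add: has_field_derivative_iff)
  then have d: "((\<lambda>t. (exp (- (t * total_rate)) - 1) / t) \<longlongrightarrow> - total_rate) (at_right 0)"
    by (simp add: filterlim_at_split)
  have c: "((\<lambda>t. exp (- (t * total_rate))) \<longlongrightarrow> exp (- (0 * total_rate))) (at_right 0)"
    by (intro tendsto_intros)
  have "((\<lambda>t. exp (- (t * total_rate)) *\<^sub>R ((opexp shifted_gen t f - f) /\<^sub>R t) +
      ((exp (- (t * total_rate)) - 1) / t) *\<^sub>R f) \<longlongrightarrow>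
      exp (- (0 * total_rate)) *\<^sub>R shifted_gen f + (- total_rate) *\<^sub>R f) (at_right 0)"
    by (intro tendsto_add tendsto_scaleR c d tendsto_const
        opexp_derivative[OF bounded_linear_shifted_gen])
  moreover have "exp (- (t * total_rate)) *\<^sub>R ((opexp shifted_gen t f - f) /\<^sub>R t) +
      ((exp (- (t * total_rate)) - 1) / t) *\<^sub>R f = (semigroup t f - f) /\<^sub>R t" for t
    by (simp add: semigroup_def scaleR_diff_right scaleR_diff_left divide_inverse algebra_simps)
  ultimately show ?thesis by (simp add: shifted_gen_def)
qed

lemma semigroup_continuous: "((\<lambda>t. semigroup t f) \<longlongrightarrow> f) (at_right 0)"
proof -
  have "((\<lambda>t. f + t *\<^sub>R ((semigroup t f - f) /\<^sub>R t)) \<longlongrightarrow> f + 0 *\<^sub>R gen f) (at_right 0)"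
    by (intro tendsto_add tendsto_scaleR tendsto_const tendsto_ident_at semigroup_derivative)
  then have "((\<lambda>t. f + t *\<^sub>R ((semigroup t f - f) /\<^sub>R t)) \<longlongrightarrow> f) (at_right 0)" by simp
  then show ?thesis
    by (rule Lim_transform_eventually) (auto simp: eventually_at_right_field intro!: exI[of _ 1])
qed

lemma markov_semigroup: "markov_semigroup semigroup"
proof -
  have "semigroup 0 f = f" for f
    by (simp add: semigroup_def opexp_0[OF bounded_linear_shifted_gen])
  moreover have "exp (- ((s + t) * total_rate)) = exp (- (s * total_rate)) * exp (- (t * total_rate))" for s t
    by (simp add: algebra_simps flip: exp_add)
  then have "semigroup (s + t) f = semigroup s (semigroup t f)" for s t f
    by (simp add: semigroup_def opexp_semigroup[OF bounded_linear_shifted_gen]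
        opexp_scaleR[OF bounded_linear_shifted_gen])
  ultimately show ?thesis
    unfolding markov_semigroup_def
    using semigroup_closure_core_D semigroup_add semigroup_scaleR semigroup_continuous
      semigroup_const semigroup_nonneg by blast
qed

text \<open>A bounded operator is closed, so closing its restriction to a subspace only replaces the
  subspace by its closure.\<close>

lemma graph_closure:
  "closure ((\<lambda>f. (f, gen f)) ` core_D) = (\<lambda>f. (f, gen f)) ` closure core_D"
proof
  have cont: "continuous_on A gen" for A by (rule linear_continuous_on[OF bounded_linear_gen])
  have "(\<lambda>f. (f, gen f)) ` closure core_D = closure core_D \<times> UNIV \<inter> {z. snd z = gen (fst z)}"
    by (auto simp: image_iff)
  moreover have "closed (closure core_D \<times> UNIV \<inter> {z. snd z = gen (fst z)})"
    by (intro closed_Int closed_Times closed_closure closed_UNIV closed_Collect_eq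
        continuous_on_snd continuous_on_id continuous_on_compose2[OF cont continuous_on_fst]) auto
  ultimately show "closure ((\<lambda>f. (f, gen f)) ` core_D) \<subseteq> (\<lambda>f. (f, gen f)) ` closure core_D"
    by (intro closure_minimal image_mono closure_subset) simp
  show "(\<lambda>f. (f, gen f)) ` closure core_D \<subseteq> closure ((\<lambda>f. (f, gen f)) ` core_D)"
    by (intro image_closure_subset continuous_on_Pair continuous_on_id cont closed_closure
        closure_subset)
qed

theorem generates_semigroup: "generates b p semigroup"
  unfolding generates_def
proof (intro conjI ballI)
  show "markov_semigroup semigroup" by (rule markov_semigroup)
  show "\<exists>g\<in>closure core_D. apply_bcontfun g = generator_L b p (apply_bcontfun f)"
    if "f \<in> core_D" for f
    using that gen_closure_core_D apply_gen closure_subset by blast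
  have iff: "((\<lambda>t. (semigroup t f - f) /\<^sub>R t) \<longlongrightarrow> g) (at_right 0) \<longleftrightarrow> g = gen f" for f g
    using semigroup_derivative tendsto_unique[OF trivial_limit_at_right_real] by blast
  have "{(f, g). f \<in> closure core_D \<and> g \<in> closure core_D \<and>
      ((\<lambda>t. (semigroup t f - f) /\<^sub>R t) \<longlongrightarrow> g) (at_right 0)} = (\<lambda>f. (f, gen f)) ` closure core_D"
    unfolding iff using gen_closure_core_D by auto
  moreover have "{(f, g). f \<in> core_D \<and> apply_bcontfun g = generator_L b p (apply_bcontfun f)} =
      (\<lambda>f. (f, gen f)) ` core_D"
    by (auto simp: apply_gen[symmetric] apply_bcontfun_inject)
  ultimately show "{(f, g). f \<in> closure core_D \<and> g \<in> closure core_D \<and>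
      ((\<lambda>t. (semigroup t f - f) /\<^sub>R t) \<longlongrightarrow> g) (at_right 0)} =
      closure {(f, g). f \<in> core_D \<and> apply_bcontfun g = generator_L b p (apply_bcontfun f)}"
    using graph_closure by simp
qed

lemma semigroup_invariant_functional:
  assumes "bounded_linear l" "\<And>f. l (gen f) = (0::real)"
  shows "l (semigroup t f) = l f"
proof -
  have "l (opexp shifted_gen t f) = exp (t * total_rate) * l f"
    by (rule opexp_eigenfunctional[OF bounded_linear_shifted_gen assms(1)])
      (simp add: shifted_gen_def assms(2) linear_add[OF bounded_linear.linear[OF assms(1)]]
        linear_scale[OF bounded_linear.linear[OF assms(1)]])
  then show ?thesis
    by (simp add: semigroup_def linear_scale[OF bounded_linear.linear[OF assms(1)]] flip: exp_add)
qed

end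

section \<open>Reversible product measures\<close>

lemma sets_config_space: "sets config_space = sets borel"
proof -
  have "sets (PiM UNIV (\<lambda>_::nat. count_space (UNIV :: nat set))) = sets (PiM UNIV (\<lambda>_::nat. borel :: nat measure))"
    by (intro sets_PiM_cong) (simp_all add: sets_borel_eq_count_space)
  then show ?thesis
    unfolding config_space_def by (simp add: sets_PiM_equal_borel)
qed

locale reversible_kernel = summable_kernel b p for b p +
  fixes w :: "nat \<Rightarrow> nat \<Rightarrow> real" and \<mu> :: "config measure"
  assumes b_0: "b 0 j = 0"
    and w_nonneg: "0 \<le> w x n"
    and w_sums: "w x sums 1"
    and detailed_balance: "w x (Suc n) * w y m * (p x y * b (Suc n) m) =
      w x n * w y (Suc m) * (p y x * b (Suc m) n)"
    and \<mu>_def: "\<mu> = PiM UNIV (\<lambda>x. point_measure UNIV (\<lambda>n. ennreal (w x n)))"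
begin

abbreviation "site x \<equiv> point_measure UNIV (\<lambda>n. ennreal (w x n))"

lemma nn_integral_site: "(\<integral>\<^sup>+n. F n \<partial>site x) = (\<Sum>n. ennreal (w x n) * F n)"
  by (simp add: point_measure_def nn_integral_density nn_integral_count_space_nat)

lemma prob_space_site: "prob_space (site x)"
proof
  have "emeasure (site x) (space (site x)) = (\<Sum>n. ennreal (w x n))"
    using nn_integral_site[of x "\<lambda>_. 1"] by simp
  also have "\<dots> = 1"
    using suminf_ennreal2[OF w_nonneg sums_summable[OF w_sums]] sums_unique[OF w_sums[of x]] by simp
  finally show "emeasure (site x) (space (site x)) = 1" .
qed

lemma sets_\<mu>: "sets \<mu> = sets config_space"
  unfolding \<mu>_def config_space_def by (intro sets_PiM_cong) (simp_all add: sets_point_measure)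

lemma sets_\<mu>_borel [measurable_cong]: "sets \<mu> = sets borel"
  by (simp add: sets_\<mu> sets_config_space)

lemma space_\<mu> [simp]: "space \<mu> = UNIV"
  using sets_eq_imp_space_eq[OF sets_\<mu>_borel] by simp

lemma prob_space_\<mu>: "prob_space \<mu>"
  unfolding \<mu>_def by (intro prob_space_PiM prob_space_site)

sublocale prob_space \<mu> by (rule prob_space_\<mu>)

lemma measurable_continuous [measurable (raw)]:
  "continuous_on UNIV f \<Longrightarrow> f \<in> measurable \<mu> borel"
  using borel_measurable_continuous_onI measurable_cong_sets[OF sets_\<mu>_borel refl] by blast

lemma measurable_bcontfun [measurable]:
  fixes f :: "config \<Rightarrow>\<^sub>C real"
  shows "apply_bcontfun f \<in> borel_measurable \<mu>"
  by (rule measurable_continuous) simp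

lemma measurable_config_map: "continuous_on UNIV f \<Longrightarrow> f \<in> measurable \<mu> \<mu>"
  using measurable_continuous measurable_cong_sets[OF refl sets_\<mu>_borel] by blast

lemma measurable_jump [measurable]: "(\<lambda>\<eta>. jump \<eta> x y) \<in> measurable \<mu> \<mu>"
  by (rule measurable_config_map[OF continuous_on_jump])

lemma measurable_fun_upd_config [measurable]: "(\<lambda>\<eta>. \<eta>(x := n)) \<in> measurable \<mu> \<mu>"
  by (intro measurable_config_map continuous_on_coordinatewise_then_product
      continuous_on_finite_dependence[where J = "{_}"]) auto

lemma measurable_b [measurable]: "(\<lambda>\<eta>. b (\<eta> x) (\<eta> y)) \<in> borel_measurable \<mu>"
  by (intro measurable_continuous continuous_on_finite_dependence[where J = "{x, y}"]) auto

text \<open>This form of Fubini's theorem never removes a site from the product: a sample whose value at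
  \<open>x\<close> is overwritten by an independent draw from the marginal at \<open>x\<close> has the same law. So it can be
  applied twice, to the two ends of a bond, without changing the underlying measure.\<close>

lemma nn_integral_resample:
  assumes [measurable]: "F \<in> borel_measurable \<mu>"
  shows "(\<integral>\<^sup>+\<eta>. F \<eta> \<partial>\<mu>) = (\<Sum>n. ennreal (w x n) * (\<integral>\<^sup>+\<eta>. F (\<eta>(x := n)) \<partial>\<mu>))"
proof -
  have D: "distr (site x \<Otimes>\<^sub>M \<mu>) \<mu> (\<lambda>(n, \<eta>). \<eta>(x := n)) = \<mu>"
    using distr_pair_PiM_eq_PiM[of UNIV site x] prob_space_site unfolding \<mu>_def by simp
  have m: "(\<lambda>(n, \<eta>). \<eta>(x := n)) \<in> measurable (site x \<Otimes>\<^sub>M \<mu>) \<mu>"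
    unfolding \<mu>_def split_beta' by (rule measurable_fun_upd[where J = UNIV]) auto
  have "(\<integral>\<^sup>+\<eta>. F \<eta> \<partial>\<mu>) = (\<integral>\<^sup>+\<eta>. F \<eta> \<partial>distr (site x \<Otimes>\<^sub>M \<mu>) \<mu> (\<lambda>(n, \<eta>). \<eta>(x := n)))"
    unfolding D ..
  also have "\<dots> = (\<integral>\<^sup>+z. F ((\<lambda>(n, \<eta>). \<eta>(x := n)) z) \<partial>(site x \<Otimes>\<^sub>M \<mu>))"
    by (rule nn_integral_distr[OF m]) measurable
  also have "\<dots> = (\<integral>\<^sup>+n. \<integral>\<^sup>+\<eta>. F (\<eta>(x := n)) \<partial>\<mu> \<partial>site x)"
    using nn_integral_fst[OF measurable_compose[OF m assms]] by simp
  finally show ?thesis unfolding nn_integral_site .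
qed

lemma suminf_ennreal_drop_zero: "f 0 = 0 \<Longrightarrow> (\<Sum>n. f n) = (\<Sum>n. f (Suc n) :: ennreal)"
  using sums_unique[OF sums_Suc[OF summable_sums[OF summableI], of f]] by simp

text \<open>Detailed balance at the level of configurations: after resampling the two sites of a bond,
  both sides are sums over their occupation numbers, which agree term by term once the terms with an
  empty departure site are discarded.\<close>

lemma nn_integral_reversible:
  assumes "x \<noteq> y" and [measurable]: "F \<in> borel_measurable \<mu>"
  shows "(\<integral>\<^sup>+\<eta>. ennreal (p x y * b (\<eta> x) (\<eta> y)) * F (jump \<eta> x y) \<partial>\<mu>) =
    (\<integral>\<^sup>+\<eta>. ennreal (p y x * b (\<eta> y) (\<eta> x)) * F \<eta> \<partial>\<mu>)"
proof -
  define J where "J n m = (\<integral>\<^sup>+\<eta>. F (\<eta>(y := m, x := n)) \<partial>\<mu>)" for n m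
  have two: "(\<integral>\<^sup>+\<eta>. ennreal (c (\<eta> x) (\<eta> y)) * G \<eta> \<partial>\<mu>) =
      (\<Sum>n. \<Sum>m. ennreal (w x n * w y m * c n m) * (\<integral>\<^sup>+\<eta>. G (\<eta>(y := m, x := n)) \<partial>\<mu>))"
    if [measurable]: "G \<in> borel_measurable \<mu>" "(\<lambda>\<eta>. c (\<eta> x) (\<eta> y)) \<in> borel_measurable \<mu>"
      and c: "\<And>n m. 0 \<le> c n m" for G c
  proof -
    have "(\<integral>\<^sup>+\<eta>. ennreal (c (\<eta> x) (\<eta> y)) * G \<eta> \<partial>\<mu>) = (\<Sum>n. ennreal (w x n) *
        (\<integral>\<^sup>+\<eta>. ennreal (c n (\<eta> y)) * G (\<eta>(x := n)) \<partial>\<mu>))"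
      by (subst nn_integral_resample[where x = x]) (use \<open>x \<noteq> y\<close> in auto)
    also have "\<dots> = (\<Sum>n. ennreal (w x n) * (\<Sum>m. ennreal (w y m) *
        (\<integral>\<^sup>+\<eta>. ennreal (c n m) * G (\<eta>(y := m, x := n)) \<partial>\<mu>)))"
    proof (intro suminf_cong arg_cong2[where f = "(*)"] refl)
      fix n
      have "(\<lambda>\<eta>. c n (\<eta> y)) \<in> borel_measurable \<mu>"
        by (intro measurable_continuous continuous_on_finite_dependence[where J = "{y}"]) auto
      then show "(\<integral>\<^sup>+\<eta>. ennreal (c n (\<eta> y)) * G (\<eta>(x := n)) \<partial>\<mu>) =
          (\<Sum>m. ennreal (w y m) * (\<integral>\<^sup>+\<eta>. ennreal (c n m) * G (\<eta>(y := m, x := n)) \<partial>\<mu>))"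
        by (subst nn_integral_resample[where x = y]) auto
    qed
    also have "\<dots> = (\<Sum>n. \<Sum>m. ennreal (w x n * w y m * c n m) * (\<integral>\<^sup>+\<eta>. G (\<eta>(y := m, x := n)) \<partial>\<mu>))"
      by (simp add: nn_integral_cmult ennreal_mult c w_nonneg mult.assoc flip: ennreal_suminf_cmult)
    finally show ?thesis .
  qed
  have J_jump: "(\<integral>\<^sup>+\<eta>. F (jump (\<eta>(y := m, x := Suc n)) x y) \<partial>\<mu>) = J n (Suc m)" for n m
  proof -
    have "jump (\<eta>(y := m, x := Suc n)) x y = \<eta>(y := Suc m, x := n)" for \<eta>
      using \<open>x \<noteq> y\<close> by (auto simp: jump_def fun_eq_iff)
    then show ?thesis by (simp add: J_def)
  qed
  have "(\<integral>\<^sup>+\<eta>. ennreal (p x y * b (\<eta> x) (\<eta> y)) * F (jump \<eta> x y) \<partial>\<mu>) =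
      (\<Sum>n. \<Sum>m. ennreal (w x n * w y m * (p x y * b n m)) *
        (\<integral>\<^sup>+\<eta>. F (jump (\<eta>(y := m, x := n)) x y) \<partial>\<mu>))"
    by (rule two[of "\<lambda>\<eta>. F (jump \<eta> x y)" "\<lambda>n m. p x y * b n m"]) (auto simp: p_nonneg b_nonneg)
  also have "\<dots> = (\<Sum>n. \<Sum>m. ennreal (w x (Suc n) * w y m * (p x y * b (Suc n) m)) * J n (Suc m))"
    by (subst suminf_ennreal_drop_zero) (simp_all add: b_0 J_jump)
  also have "\<dots> = (\<Sum>n. \<Sum>m. ennreal (w x n * w y (Suc m) * (p y x * b (Suc m) n)) * J n (Suc m))"
    by (simp only: detailed_balance)
  also have "\<dots> = (\<Sum>n. \<Sum>m. ennreal (w x n * w y m * (p y x * b m n)) * J n m)"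
    by (intro suminf_cong suminf_ennreal_drop_zero[symmetric]) (simp add: b_0)
  also have "\<dots> = (\<integral>\<^sup>+\<eta>. ennreal (p y x * b (\<eta> y) (\<eta> x)) * F \<eta> \<partial>\<mu>)"
    unfolding J_def
    by (rule two[of F "\<lambda>n m. p y x * b m n", symmetric]) (auto simp: p_nonneg b_nonneg)
  finally show ?thesis .
qed

text \<open>Stationarity is needed not only for \<open>\<mu>\<close> but also for its restrictions to invariant sets, from
  which the action of the semigroup on their indicators is obtained.\<close>

definition restricted_integral :: "config set \<Rightarrow> (config \<Rightarrow>\<^sub>C real) \<Rightarrow> real" where
  "restricted_integral A f = (\<integral>\<eta>. indicator A \<eta> * apply_bcontfun f \<eta> \<partial>\<mu>)"

lemma integrable_sup_bounded:
  fixes u :: "config \<Rightarrow> real"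
  assumes "u \<in> borel_measurable \<mu>" "\<And>\<eta>. \<bar>u \<eta>\<bar> \<le> K"
  shows "integrable \<mu> u"
  by (rule integrable_const_bound[where B = K]) (use assms in auto)

lemma integrable_restricted:
  fixes f :: "config \<Rightarrow>\<^sub>C real"
  assumes [measurable]: "A \<in> sets \<mu>"
  shows "integrable \<mu> (\<lambda>\<eta>. indicator A \<eta> * apply_bcontfun f \<eta>)"
proof (rule integrable_sup_bounded)
  show "\<bar>indicator A \<eta> * apply_bcontfun f \<eta>\<bar> \<le> norm f" for \<eta>
    using abs_apply_le_norm[of f \<eta>] by (simp add: indicator_def)
qed measurable

lemma norm_restricted_integral_le:
  assumes "A \<in> sets \<mu>"
  shows "norm (restricted_integral A f) \<le> norm f"
proof -
  have "norm (restricted_integral A f) \<le> (\<integral>\<eta>. norm f \<partial>\<mu>)"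
    unfolding restricted_integral_def
    by (intro integral_norm_bound[THEN order_trans] integral_mono integrable_norm
        integrable_restricted assms)
      (use abs_apply_le_norm[of f] in \<open>auto simp: indicator_def\<close>)
  then show ?thesis using prob_space by simp
qed

lemma bounded_linear_restricted_integral:
  assumes [measurable]: "A \<in> sets \<mu>"
  shows "bounded_linear (restricted_integral A)"
proof (rule bounded_linear_intro[where K = 1])
  fix f g c
  show "restricted_integral A (f + g) = restricted_integral A f + restricted_integral A g"
    unfolding restricted_integral_def by (simp add: distrib_left integrable_restricted[OF assms])
  show "restricted_integral A (c *\<^sub>R f) = c *\<^sub>R restricted_integral A f"
    unfolding restricted_integral_def by (simp add: mult.left_commute)
  show "norm (restricted_integral A f) \<le> norm f * 1"
    using norm_restricted_integral_le[OF assms] by simp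
qed

definition jump_invariant :: "config set \<Rightarrow> bool" where
  "jump_invariant A \<longleftrightarrow> (\<forall>\<eta> x y. 0 < \<eta> x \<longrightarrow> (jump \<eta> x y \<in> A \<longleftrightarrow> \<eta> \<in> A))"

lemma jump_invariant_Compl: "jump_invariant A \<Longrightarrow> jump_invariant (- A)"
  by (simp add: jump_invariant_def)

text \<open>The lemma \<open>nn_integral_reversible\<close> concerns nonnegative integrands, so \<open>f\<close> is first shifted by its norm. The
  indicator of \<open>A\<close> can be moved through the jump because \<open>A\<close> is invariant.\<close>

lemma restricted_reversible:
  assumes [measurable]: "A \<in> sets \<mu>" and inv: "jump_invariant A"
  shows "p x y * restricted_integral A (gain x y f) = p y x * restricted_integral A (loss y x f)"
proof (cases "x = y")
  case True
  have "gain x x f = loss x x f"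
  proof (rule bcontfun_eqI)
    fix \<eta>
    have "jump \<eta> x x = \<eta>" if "\<eta> x \<noteq> 0" using that by (auto simp: jump_def fun_eq_iff)
    then show "apply_bcontfun (gain x x f) \<eta> = apply_bcontfun (loss x x f) \<eta>"
      by (cases "\<eta> x = 0") (simp_all add: apply_gain apply_loss b_0)
  qed
  then show ?thesis using True by simp
next
  case False
  have nonneg: "p x y * restricted_integral A (gain x y g) = p y x * restricted_integral A (loss y x g)"
    if g: "\<And>\<eta>. 0 \<le> apply_bcontfun g \<eta>" for g
  proof -
    define F where "F \<eta> = indicator A \<eta> * apply_bcontfun g \<eta>" for \<eta>
    have F: "0 \<le> F \<eta>" for \<eta> unfolding F_def using g by simp
    have [measurable]: "F \<in> borel_measurable \<mu>" unfolding F_def by measurable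
    have pre: "indicator A \<eta> * apply_bcontfun (gain x y g) \<eta> = b (\<eta> x) (\<eta> y) * F (jump \<eta> x y)" for \<eta>
      using inv by (cases "\<eta> x = 0") (auto simp: F_def apply_gain b_0 jump_invariant_def indicator_def)
    have "p x y * restricted_integral A (gain x y g) =
        (\<integral>\<eta>. (p x y * b (\<eta> x) (\<eta> y)) * F (jump \<eta> x y) \<partial>\<mu>)"
      unfolding restricted_integral_def pre by (simp add: mult.assoc)
    also have "\<dots> = enn2real (\<integral>\<^sup>+\<eta>. ennreal ((p x y * b (\<eta> x) (\<eta> y)) * F (jump \<eta> x y)) \<partial>\<mu>)"
      by (rule integral_eq_nn_integral) (auto simp: p_nonneg b_nonneg F)
    also have "\<dots> = enn2real (\<integral>\<^sup>+\<eta>. ennreal ((p y x * b (\<eta> y) (\<eta> x)) * F \<eta>) \<partial>\<mu>)"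
      using nn_integral_reversible[OF False, of "\<lambda>\<eta>. ennreal (F \<eta>)"]
      by (simp add: ennreal_mult p_nonneg b_nonneg F)
    also have "\<dots> = (\<integral>\<eta>. (p y x * b (\<eta> y) (\<eta> x)) * F \<eta> \<partial>\<mu>)"
      by (rule integral_eq_nn_integral[symmetric]) (auto simp: p_nonneg b_nonneg F)
    also have "\<dots> = (\<integral>\<eta>. p y x * (indicator A \<eta> * apply_bcontfun (loss y x g) \<eta>) \<partial>\<mu>)"
      by (simp add: apply_loss F_def mult_ac)
    also have "\<dots> = p y x * restricted_integral A (loss y x g)"
      unfolding restricted_integral_def by simp
    finally show ?thesis .
  qed
  let ?K = "const_bcontfun (norm f) :: config \<Rightarrow>\<^sub>C real"
  note lin = linear_add[OF bounded_linear.linear[OF bounded_linear_restricted_integral[OF assms(1)]]]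
  have "p x y * restricted_integral A (gain x y (f + ?K)) = p y x * restricted_integral A (loss y x (f + ?K))"
  proof (rule nonneg)
    show "0 \<le> apply_bcontfun (f + ?K) \<eta>" for \<eta>
      using abs_apply_le_norm[of f \<eta>] by simp
  qed
  moreover have "p x y * restricted_integral A (gain x y ?K) = p y x * restricted_integral A (loss y x ?K)"
    by (rule nonneg) simp
  ultimately show ?thesis by (simp add: gain_loss_linear lin distrib_left)
qed

text \<open>Reversibility pairs the gain of each bond with the loss of the reversed bond, so the two
  parts of the generator have the same integral.\<close>

lemma restricted_integral_gen:
  assumes A: "A \<in> sets \<mu>" and inv: "jump_invariant A"
  shows "restricted_integral A (gen f) = 0"
proof -
  let ?l = "restricted_integral A"
  note bl = bounded_linear_restricted_integral[OF A]
  have s: "(\<lambda>(x, y). p x y * ?l (gain x y f)) summable_on UNIV"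
      "(\<lambda>(x, y). p x y * ?l (loss x y f)) summable_on UNIV"
    using summable_weighted[OF order_trans[OF norm_restricted_integral_le[OF A] norm_gain_le]]
      summable_weighted[OF order_trans[OF norm_restricted_integral_le[OF A] norm_loss_le]]
    by simp_all
  have "?l (gen f) = (\<Sum>\<^sub>\<infinity>z. (case z of (x, y) \<Rightarrow> p x y * ?l (gain x y f)) -
      (case z of (x, y) \<Rightarrow> p x y * ?l (loss x y f)))"
    unfolding bounded_linear_gen_sum[OF bl] linear_diff[OF bounded_linear.linear[OF bl]]
    by (simp add: case_prod_unfold right_diff_distrib)
  also have "\<dots> = (\<Sum>\<^sub>\<infinity>(x, y)\<in>UNIV. p x y * ?l (gain x y f)) - (\<Sum>\<^sub>\<infinity>(x, y)\<in>UNIV. p x y * ?l (loss x y f))"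
    unfolding diff_conv_add_uminus
    by (rule infsumI[OF has_sum_add[OF has_sum_infsum[OF s(1)] has_sum_uminusI[OF has_sum_infsum[OF s(2)]]]])
  also have "(\<Sum>\<^sub>\<infinity>(x, y)\<in>UNIV. p x y * ?l (gain x y f)) =
      (\<Sum>\<^sub>\<infinity>z\<in>UNIV. (case prod.swap z of (x, y) \<Rightarrow> p x y * ?l (loss x y f)))"
    by (rule infsum_cong) (auto simp: restricted_reversible[OF A inv])
  also have "\<dots> = (\<Sum>\<^sub>\<infinity>(x, y)\<in>UNIV. p x y * ?l (loss x y f))"
    by (rule infsum_reindex_bij_betw[OF bij_swap])
  finally show ?thesis by simp
qed

lemma restricted_integral_semigroup:
  assumes "A \<in> sets \<mu>" "jump_invariant A"
  shows "restricted_integral A (semigroup t f) = restricted_integral A f"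
  by (intro semigroup_invariant_functional bounded_linear_restricted_integral
      restricted_integral_gen assms)

lemma stationary: "\<mu> \<in> stationary_measures semigroup"
proof -
  have "(\<integral>\<eta>. apply_bcontfun (semigroup t f) \<eta> \<partial>\<mu>) = (\<integral>\<eta>. apply_bcontfun f \<eta> \<partial>\<mu>)" for t f
    using restricted_integral_semigroup[of UNIV t f] sets.top[of \<mu>]
    by (simp add: restricted_integral_def jump_invariant_def)
  then show ?thesis
    unfolding stationary_measures_def using prob_space_\<mu> sets_\<mu> by blast
qed

section \<open>Invariant sets\<close>

definition square :: "(config \<Rightarrow>\<^sub>C real) \<Rightarrow> config \<Rightarrow>\<^sub>C real" where
  "square f = Bcontfun (\<lambda>\<eta>. (apply_bcontfun f \<eta>)\<^sup>2)"

lemma apply_square: "apply_bcontfun (square f) \<eta> = (apply_bcontfun f \<eta>)\<^sup>2"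
proof -
  have "apply_bcontfun (square f) = (\<lambda>\<eta>. (apply_bcontfun f \<eta>)\<^sup>2)"
    unfolding square_def
  proof (rule apply_Bcontfun)
    show "\<bar>(apply_bcontfun f \<eta>)\<^sup>2\<bar> \<le> (norm f)\<^sup>2" for \<eta>
      using abs_apply_le_norm[of f \<eta>] by (simp add: abs_le_square_iff[symmetric])
  qed (intro continuous_on_power continuous_on_apply_bcontfun)
  then show ?thesis by simp
qed

text \<open>Jensen's inequality for the square: positivity applied to \<open>(f - a)\<^sup>2\<close> with the constant
  \<open>a = S t f \<eta>\<close>.\<close>

lemma semigroup_square:
  assumes "t \<ge> 0"
  shows "(apply_bcontfun (semigroup t f) \<eta>)\<^sup>2 \<le> apply_bcontfun (semigroup t (square f)) \<eta>"
proof -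
  define a where "a = apply_bcontfun (semigroup t f) \<eta>"
  have "0 \<le> apply_bcontfun (semigroup t (square (f - const_bcontfun a))) \<eta>"
    by (rule semigroup_nonneg[OF assms]) (simp add: apply_square)
  also have "square (f - const_bcontfun a) = square f - (2 * a) *\<^sub>R f + const_bcontfun (a\<^sup>2)"
    by (rule bcontfun_eqI) (simp add: apply_square power2_diff)
  finally show ?thesis
    by (simp add: semigroup_add semigroup_diff semigroup_scaleR semigroup_const a_def[symmetric]
        power2_eq_square)
qed

text \<open>On \<open>A\<close> the difference is the image of \<open>f - 1\<close> under the semigroup, off \<open>A\<close> it is the image of
  \<open>f\<close>. After Jensen's inequality on both parts, the restrictions of \<open>\<mu>\<close> to \<open>A\<close> and to its
  complement are stationary.\<close>

lemma semigroup_L2_contraction: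
  assumes A [measurable]: "A \<in> sets \<mu>" and inv: "jump_invariant A" and "t \<ge> 0"
  shows "(\<integral>\<eta>. (apply_bcontfun (semigroup t f) \<eta> - indicator A \<eta>)\<^sup>2 \<partial>\<mu>) \<le>
    (\<integral>\<eta>. (apply_bcontfun f \<eta> - indicator A \<eta>)\<^sup>2 \<partial>\<mu>)"
proof -
  let ?S = "semigroup t" and ?g = "f - const_bcontfun 1"
  have A': "- A \<in> sets \<mu>" using A by (simp add: sets_\<mu>_borel borel_comp)
  have split: "(\<integral>\<eta>. indicator A \<eta> * apply_bcontfun u \<eta> + indicator (- A) \<eta> * apply_bcontfun v \<eta> \<partial>\<mu>) =
      restricted_integral A u + restricted_integral (- A) v" for u v
    unfolding restricted_integral_def
    by (rule Bochner_Integration.integral_add) (intro integrable_restricted A A')+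
  have "(\<integral>\<eta>. (apply_bcontfun (?S f) \<eta> - indicator A \<eta>)\<^sup>2 \<partial>\<mu>) \<le>
      (\<integral>\<eta>. indicator A \<eta> * apply_bcontfun (?S (square ?g)) \<eta> +
        indicator (- A) \<eta> * apply_bcontfun (?S (square f)) \<eta> \<partial>\<mu>)"
  proof (rule integral_mono)
    show "integrable \<mu> (\<lambda>\<eta>. (apply_bcontfun (?S f) \<eta> - indicator A \<eta>)\<^sup>2)"
    proof (rule integrable_sup_bounded)
      fix \<eta>
      have "\<bar>apply_bcontfun (?S f) \<eta> - indicator A \<eta>\<bar> \<le> norm (?S f) + 1"
        using abs_apply_le_norm[of "?S f" \<eta>] by (auto simp: indicator_def)
      then show "\<bar>(apply_bcontfun (?S f) \<eta> - indicator A \<eta>)\<^sup>2\<bar> \<le> (norm (?S f) + 1)\<^sup>2"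
        by (simp add: abs_le_square_iff[symmetric])
    qed measurable
    show "integrable \<mu> (\<lambda>\<eta>. indicator A \<eta> * apply_bcontfun (?S (square ?g)) \<eta> +
        indicator (- A) \<eta> * apply_bcontfun (?S (square f)) \<eta>)"
      by (intro Bochner_Integration.integrable_add integrable_restricted A A')
    show "(apply_bcontfun (?S f) \<eta> - indicator A \<eta>)\<^sup>2 \<le>
        indicator A \<eta> * apply_bcontfun (?S (square ?g)) \<eta> +
        indicator (- A) \<eta> * apply_bcontfun (?S (square f)) \<eta>" for \<eta>
      using semigroup_square[OF \<open>t \<ge> 0\<close>, of ?g \<eta>] semigroup_square[OF \<open>t \<ge> 0\<close>, of f \<eta>]
      by (auto simp: indicator_def semigroup_diff semigroup_const)
  qed
  also have "\<dots> = (\<integral>\<eta>. indicator A \<eta> * apply_bcontfun (square ?g) \<eta> +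
      indicator (- A) \<eta> * apply_bcontfun (square f) \<eta> \<partial>\<mu>)"
    unfolding split restricted_integral_semigroup[OF A inv]
      restricted_integral_semigroup[OF A' jump_invariant_Compl[OF inv]] ..
  also have "\<dots> = (\<integral>\<eta>. (apply_bcontfun f \<eta> - indicator A \<eta>)\<^sup>2 \<partial>\<mu>)"
    by (rule Bochner_Integration.integral_cong) (auto simp: apply_square indicator_def)
  finally show ?thesis .
qed

text \<open>The L2 extension of the semigroup is a choice among functions with a limit property. For an
  invariant set \<open>A\<close> the indicator has this property by the contraction estimate, and the property
  determines the function almost everywhere because the indicator is an L2 limit of elements of
  the closure of \<^const>\<open>core_D\<close>.\<close>

lemma L2_extension_invariant:
  assumes A [measurable]: "A \<in> sets \<mu>" and inv: "jump_invariant A" and "t \<ge> 0"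
    and F: "\<And>n. F n \<in> closure core_D" "L2_converges \<mu> F (indicator A)"
  shows "AE \<eta> in \<mu>. L2_extension semigroup \<mu> t (indicator A) \<eta> = indicator A \<eta>"
proof -
  let ?S = "semigroup t" and ?I = "indicator A :: config \<Rightarrow> real"
  define P where "P g \<longleftrightarrow> square_integrable \<mu> g \<and>
     (\<forall>F. (\<forall>n. F n \<in> closure core_D) \<longrightarrow> L2_converges \<mu> F ?I \<longrightarrow>
        L2_converges \<mu> (\<lambda>n. ?S (F n)) g)" for g
  have conv: "L2_converges \<mu> (\<lambda>n. ?S (F n)) ?I" if "L2_converges \<mu> F ?I" for F
  proof -
    have "(\<lambda>n. \<integral>\<eta>. (apply_bcontfun (F n) \<eta> - ?I \<eta>)\<^sup>2 \<partial>\<mu>) \<longlonglongrightarrow> 0"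
      using that by (simp add: L2_converges_def)
    then show ?thesis
      unfolding L2_converges_def
      by (rule tendsto_sandwich[OF _ _ tendsto_const, rotated 2])
        (simp_all add: semigroup_L2_contraction[OF A inv \<open>t \<ge> 0\<close>])
  qed
  have "(?I \<eta>)\<^sup>2 = ?I \<eta>" for \<eta> by (simp add: indicator_def)
  then have I2: "integrable \<mu> (\<lambda>\<eta>. (?I \<eta>)\<^sup>2)" by (simp add: emeasure_eq_measure)
  have "P ?I"
    unfolding P_def square_integrable_def using conv I2 by auto
  define g where "g = L2_extension semigroup \<mu> t ?I"
  have "P g"
    unfolding g_def L2_extension_def P_def[symmetric] by (rule someI[of P, OF \<open>P ?I\<close>])
  then have g [measurable]: "g \<in> borel_measurable \<mu>" and g2: "integrable \<mu> (\<lambda>\<eta>. (g \<eta>)\<^sup>2)"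
    and gF: "L2_converges \<mu> (\<lambda>n. ?S (F n)) g"
    using F unfolding P_def square_integrable_def by auto
  let ?u = "\<lambda>n \<eta>. (apply_bcontfun (?S (F n)) \<eta> - g \<eta>)\<^sup>2"
  let ?v = "\<lambda>n \<eta>. (apply_bcontfun (?S (F n)) \<eta> - ?I \<eta>)\<^sup>2"
  have two: "(x - y)\<^sup>2 \<le> 2 * x\<^sup>2 + 2 * y\<^sup>2" for x y :: real
    using sum_squares_bound[of x "- y"] by (simp add: power2_diff)
  have bounded_diff: "integrable \<mu> (\<lambda>\<eta>. (u \<eta> - v \<eta>)\<^sup>2)"
    if [measurable]: "u \<in> borel_measurable \<mu>" "v \<in> borel_measurable \<mu>"
      and "integrable \<mu> (\<lambda>\<eta>. (u \<eta>)\<^sup>2)" "integrable \<mu> (\<lambda>\<eta>. (v \<eta>)\<^sup>2)" for u v :: "config \<Rightarrow> real"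
    by (rule Bochner_Integration.integrable_bound[where f = "\<lambda>\<eta>. 2 * (u \<eta>)\<^sup>2 + 2 * (v \<eta>)\<^sup>2"])
      (use that two in auto)
  have S2: "integrable \<mu> (\<lambda>\<eta>. (apply_bcontfun f \<eta>)\<^sup>2)" for f :: "config \<Rightarrow>\<^sub>C real"
    using integrable_restricted[of UNIV "square f"] by (simp add: apply_square)
  have int: "integrable \<mu> (?u n)" "integrable \<mu> (?v n)" "integrable \<mu> (\<lambda>\<eta>. (g \<eta> - ?I \<eta>)\<^sup>2)" for n
    by (intro bounded_diff g2 S2 I2; measurable)+
  have le: "(\<integral>\<eta>. (g \<eta> - ?I \<eta>)\<^sup>2 \<partial>\<mu>) \<le> 2 * (\<integral>\<eta>. ?u n \<eta> \<partial>\<mu>) + 2 * (\<integral>\<eta>. ?v n \<eta> \<partial>\<mu>)" for n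
  proof -
    have "(\<integral>\<eta>. (g \<eta> - ?I \<eta>)\<^sup>2 \<partial>\<mu>) \<le> (\<integral>\<eta>. 2 * ?u n \<eta> + 2 * ?v n \<eta> \<partial>\<mu>)"
    proof (rule integral_mono)
      show "(g \<eta> - ?I \<eta>)\<^sup>2 \<le> 2 * ?u n \<eta> + 2 * ?v n \<eta>" for \<eta>
        using two[of "apply_bcontfun (?S (F n)) \<eta> - ?I \<eta>" "apply_bcontfun (?S (F n)) \<eta> - g \<eta>"] by simp
    qed (intro Bochner_Integration.integrable_add integrable_mult_right int)+
    then show ?thesis using int by simp
  qed
  have "(\<lambda>n. 2 * (\<integral>\<eta>. ?u n \<eta> \<partial>\<mu>) + 2 * (\<integral>\<eta>. ?v n \<eta> \<partial>\<mu>)) \<longlonglongrightarrow> 2 * 0 + 2 * 0"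
    using gF conv[OF F(2)] unfolding L2_converges_def by (intro tendsto_intros)
  then have "(\<integral>\<eta>. (g \<eta> - ?I \<eta>)\<^sup>2 \<partial>\<mu>) \<le> 0"
    using LIMSEQ_le_const le by fastforce
  then have "(\<integral>\<eta>. (g \<eta> - ?I \<eta>)\<^sup>2 \<partial>\<mu>) = 0"
    by (intro antisym) simp_all
  then have "AE \<eta> in \<mu>. (g \<eta> - ?I \<eta>)\<^sup>2 = 0"
    using integral_nonneg_eq_0_iff_AE[OF int(3)] by simp
  then show ?thesis unfolding g_def by (rule AE_mp) simp
qed

lemma not_ergodic:
  assumes "A \<in> sets \<mu>" "jump_invariant A" "measure \<mu> A \<notin> {0, 1}"
    and "\<And>n. F n \<in> closure core_D" "L2_converges \<mu> F (indicator A)"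
  shows "\<not> ergodic semigroup \<mu>"
  unfolding ergodic_def using L2_extension_invariant[OF assms(1,2) _ assms(4,5)] assms(1,3) sets_\<mu>
  by blast

end

section \<open>A reversible chain with finite total rate\<close>

text \<open>In the product \<open>g(i) h(j)\<close> of a function of the departure site and one of the arrival site the
  algebraic condition on \<open>b\<close> holds identically. The successive ratios of the weights are the values
  of \<open>h\<close>, and their decay has to be faster than exponential for the marginals to concentrate.\<close>

definition misanthrope_rate :: "nat \<Rightarrow> nat \<Rightarrow> real" where
  "misanthrope_rate i j = of_bool (0 < i) * (1 / 2) ^ (j\<^sup>2)"

text \<open>The rates to the right are chosen summable. Those to the left are then forced by detailed
  balance, because \<open>fugacity (Suc y) = 4 ^ y * fugacity y\<close> and \<open>4 * (1 / 8) = 1 / 2\<close>.\<close>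

definition kernel :: "nat \<Rightarrow> nat \<Rightarrow> real" where
  "kernel x y = (if y = Suc x then (1 / 2) ^ x else if x = Suc y then (1 / 8) ^ y else 0)"

text \<open>For large \<open>x\<close> the exponent is far from both \<open>(x - 1)\<^sup>2\<close> and \<open>x\<^sup>2\<close>, between which it
  lies, so the marginal at \<open>x\<close> increases steeply up to the occupation number \<open>x\<close> and decreases steeply from there on.\<close>

definition fugacity :: "nat \<Rightarrow> real" where
  "fugacity x = 2 ^ (x * (x - 1))"

definition marginal :: "nat \<Rightarrow> nat \<Rightarrow> real" where
  "marginal x n = weight misanthrope_rate n * fugacity x ^ n / partition_fun misanthrope_rate (fugacity x)"

lemma fugacity_kernel: "fugacity x * kernel x y = fugacity y * kernel y x"
proof -
  have "fugacity (Suc x) = fugacity x * 4 ^ x" for x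
  proof -
    have "Suc x * (Suc x - 1) = x * (x - 1) + 2 * x" by (cases x) simp_all
    then show ?thesis by (simp only: fugacity_def power_add power_mult) simp
  qed
  moreover have "(4::real) ^ x * (1 / 8) ^ x = (1 / 2) ^ x" for x
    by (simp flip: power_mult_distrib)
  ultimately show ?thesis by (auto simp: kernel_def mult.assoc)
qed

lemma kernel_nonneg: "0 \<le> kernel x y" and kernel_le_1: "kernel x y \<le> 1"
  by (auto simp: kernel_def power_le_one)

lemma kernel_summable: "(\<lambda>(x, y). kernel x y) summable_on UNIV"
proof -
  have geometric: "(\<lambda>n. c ^ n) summable_on UNIV" if "0 \<le> c" "c < 1" for c :: real
    using that by (subst summable_on_UNIV_nonneg_real_iff) (auto intro: summable_geometric)
  let ?up = "\<lambda>(x, y). if y = Suc x then (1 / 2) ^ x else (0::real)"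
  let ?down = "\<lambda>(x, y). if x = Suc y then (1 / 8) ^ y else (0::real)"
  have "?up summable_on UNIV \<longleftrightarrow> ?up summable_on range (\<lambda>x. (x, Suc x))"
    by (rule summable_on_cong_neutral) auto
  also have "\<dots> \<longleftrightarrow> (?up \<circ> (\<lambda>x. (x, Suc x))) summable_on UNIV"
    by (rule summable_on_reindex) (auto simp: inj_on_def)
  finally have up: "?up summable_on UNIV" using geometric[of "1 / 2"] by (simp add: comp_def)
  have "?down summable_on UNIV \<longleftrightarrow> ?down summable_on range (\<lambda>y. (Suc y, y))"
    by (rule summable_on_cong_neutral) auto
  also have "\<dots> \<longleftrightarrow> (?down \<circ> (\<lambda>y. (Suc y, y))) summable_on UNIV"
    by (rule summable_on_reindex) (auto simp: inj_on_def)
  finally have down: "?down summable_on UNIV" using geometric[of "1 / 8"] by (simp add: comp_def)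
  have "(\<lambda>z. ?up z + ?down z) summable_on UNIV" by (rule summable_on_add[OF up down])
  then show ?thesis by (rule summable_on_cong[THEN iffD1, rotated]) (auto simp: kernel_def)
qed

lemma standing_assumptions_example: "standing_assumptions misanthrope_rate kernel"
  unfolding standing_assumptions_def
proof (intro conjI allI impI)
  show "0 \<le> kernel x y" for x y by (rule kernel_nonneg)
  show "finite {y. 0 < kernel x y + kernel y x}" for x
    by (rule finite_subset[of _ "{..Suc x}"]) (auto simp: kernel_def split: if_splits)
  show "bdd_above (range (\<lambda>x. \<Sum>\<^sub>\<infinity>y. kernel x y + kernel y x))"
  proof (rule bdd_aboveI2)
    fix x
    have "(\<Sum>\<^sub>\<infinity>y. kernel x y + kernel y x) = (\<Sum>\<^sub>\<infinity>y\<in>{x - 1, Suc x}. kernel x y + kernel y x)"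
      by (rule infsum_cong_neutral) (auto simp: kernel_def)
    also have "\<dots> = (\<Sum>y\<in>{x - 1, Suc x}. kernel x y + kernel y x)" by simp
    also have "\<dots> \<le> of_nat (card {x - 1, Suc x}) * 2"
      by (rule sum_bounded_above) (use kernel_le_1 in \<open>smt (verit)\<close>)
    also have "\<dots> \<le> 4" by (simp add: card_insert_if)
    finally show "(\<Sum>\<^sub>\<infinity>y. kernel x y + kernel y x) \<le> 4" .
  qed
  show "(x, y) \<in> {(u, v). kernel u v > 0}\<^sup>*" for x y
  proof -
    define E where "E = {(u, v). kernel u v > 0}"
    have edge: "(k, Suc k) \<in> E" "(Suc k, k) \<in> E" for k by (simp_all add: E_def kernel_def)
    have "(x, 0) \<in> E\<^sup>*"
      by (induction x) (auto intro: converse_rtrancl_into_rtrancl edge)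
    moreover have "(0, y) \<in> E\<^sup>*"
      by (induction y) (auto intro: rtrancl_into_rtrancl edge)
    ultimately show ?thesis unfolding E_def by (rule rtrancl_trans)
  qed
  have "1 \<le> (INF i. misanthrope_rate (i + 1) 0 / misanthrope_rate 1 i)"
    by (rule cINF_greatest) (auto simp: misanthrope_rate_def power_one_over)
  then show "0 < (INF i. misanthrope_rate (i + 1) 0 / misanthrope_rate 1 i)" by simp
qed (auto simp: misanthrope_rate_def)

lemma fugacity_ge: "real n \<le> fugacity n" if "2 \<le> n"
proof -
  have "n \<le> n * (n - 1)" using that by (cases n) auto
  then have "(2::real) ^ n \<le> fugacity n" unfolding fugacity_def by (rule power_increasing) simp
  then show ?thesis using of_nat_less_two_power[of n, where 'a = real] by linarith
qed

lemma lambda_star_example: "lambda_star misanthrope_rate = \<infinity>"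
proof -
  have "real j \<le> 2 ^ (j\<^sup>2)" for j
  proof -
    have "real j < 2 ^ j" by (rule of_nat_less_two_power)
    also have "\<dots> \<le> 2 ^ (j\<^sup>2)" by (rule power_increasing) (auto simp: power2_eq_square)
    finally show ?thesis by simp
  qed
  then have "filterlim (\<lambda>j. 2 ^ (j\<^sup>2) :: real) at_top sequentially"
    by (intro filterlim_at_top_mono[OF filterlim_real_sequentially] always_eventually) auto
  then have "((\<lambda>j. ereal (misanthrope_rate (j + 1) 0 / misanthrope_rate 1 j)) \<longlongrightarrow> \<infinity>) sequentially"
    by (simp add: tendsto_PInfty_eq_at_top misanthrope_rate_def power_one_over)
  then show ?thesis
    unfolding lambda_star_def by (rule lim_imp_Liminf[OF sequentially_bot])
qed

subsection \<open>Concentration of the marginals\<close>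

lemma weight_ratio:
  "weight misanthrope_rate (Suc n) = weight misanthrope_rate n * (1 / 2) ^ (n\<^sup>2)"
  by (simp add: weight_def misanthrope_rate_def)

lemma weight_pos: "0 < weight misanthrope_rate n"
  by (simp add: weight_def misanthrope_rate_def prod_pos)

lemma fugacity_pos: "0 < fugacity x"
  by (simp add: fugacity_def)

lemma ratio_above: "fugacity x * (1 / 2) ^ (n\<^sup>2) \<le> (1 / 2) ^ n" if "x \<le> n"
proof -
  have "x * (x - 1) + n \<le> n * (n - 1) + n"
    using that by (intro add_right_mono mult_le_mono) auto
  also have "\<dots> = n\<^sup>2" by (cases n) (simp_all add: power2_eq_square)
  finally have "(2::real) ^ (x * (x - 1) + n) \<le> 2 ^ (n\<^sup>2)" by (rule power_increasing) simp
  then show ?thesis by (simp add: fugacity_def power_add power_one_over field_simps)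
qed

lemma ratio_below: "1 \<le> 2 * (1 / 2) ^ x * (fugacity x * (1 / 2) ^ (n\<^sup>2))" if "n < x"
proof -
  obtain k where k: "x = Suc k" "n \<le> k" using \<open>n < x\<close> by (cases x) auto
  have "n\<^sup>2 + k \<le> k * k + k" using k(2) by (simp add: power2_eq_square mult_le_mono)
  also have "\<dots> = x * (x - 1)" using k(1) by simp
  finally have "(2::real) ^ (n\<^sup>2 + k) \<le> 2 ^ (x * (x - 1))" by (rule power_increasing) simp
  then show ?thesis using k(1) by (simp add: fugacity_def power_add power_one_over field_simps)
qed

lemma summable_partition: "summable (\<lambda>n. weight misanthrope_rate n * fugacity x ^ n)"
proof (rule summable_ratio_test)
  fix n assume n: "Suc x \<le> n"
  have "fugacity x * (1 / 2) ^ (n\<^sup>2) \<le> (1 / 2) ^ n" using n by (intro ratio_above) simp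
  also have "\<dots> \<le> (1 / 2) ^ 1" using n by (intro power_decreasing) auto
  finally have "weight misanthrope_rate n * fugacity x ^ n * (fugacity x * (1 / 2) ^ (n\<^sup>2)) \<le>
      weight misanthrope_rate n * fugacity x ^ n * (1 / 2)"
    using weight_pos[of n] fugacity_pos[of x] by (intro mult_left_mono) auto
  then show "norm (weight misanthrope_rate (Suc n) * fugacity x ^ Suc n) \<le>
      1 / 2 * norm (weight misanthrope_rate n * fugacity x ^ n)"
    using weight_pos[of n] weight_pos[of "Suc n"] fugacity_pos[of x]
    by (simp add: weight_ratio abs_mult mult_ac)
qed simp

lemma partition_pos: "0 < partition_fun misanthrope_rate (fugacity x)"
  unfolding partition_fun_def
  by (rule suminf_pos[OF summable_partition]) (simp add: weight_pos fugacity_pos)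

lemma marginal_pos: "0 < marginal x n"
  by (simp add: marginal_def weight_pos fugacity_pos partition_pos)

lemma marginal_sums: "marginal x sums 1"
  using sums_divide[OF summable_sums[OF summable_partition[of x]],
      of "partition_fun misanthrope_rate (fugacity x)"] partition_pos[of x]
  by (simp add: marginal_def[abs_def] partition_fun_def)

lemma marginal_Suc: "marginal x (Suc n) = marginal x n * (fugacity x * (1 / 2) ^ (n\<^sup>2))"
  by (simp add: marginal_def weight_ratio)

text \<open>Above \<open>x\<close> each probability is compared with the previous one, below \<open>x\<close> with the next one. Both
  shifted sequences have sum at most one, so no explicit bound on the tails is needed.\<close>

lemma marginal_concentration:
  "(\<Sum>n. marginal x n * of_bool (n \<noteq> x)) \<le> 3 * (1 / 2) ^ x"
proof -
  define previous where "previous n = (case n of 0 \<Rightarrow> 0 | Suc k \<Rightarrow> marginal x k)" for n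
  have previous: "previous sums 1"
    using sums_Suc[of previous 1] marginal_sums[of x] by (simp add: previous_def)
  have "next": "(\<lambda>n. marginal x (Suc n)) sums (1 - marginal x 0)"
    using sums_Suc_iff[of "marginal x" "1 - marginal x 0"] marginal_sums[of x] by simp
  have bound: "marginal x n * of_bool (n \<noteq> x) \<le>
      (1 / 2) ^ x * previous n + 2 * (1 / 2) ^ x * marginal x (Suc n)" for n
  proof (cases n x rule: linorder_cases)
    case less
    have "marginal x n * 1 \<le> marginal x n * (2 * (1 / 2) ^ x * (fugacity x * (1 / 2) ^ (n\<^sup>2)))"
      using ratio_below[OF less] marginal_pos[of x n] by (intro mult_left_mono) auto
    then have "marginal x n \<le> 2 * (1 / 2) ^ x * marginal x (Suc n)"
      by (simp add: marginal_Suc mult_ac)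
    moreover have "0 \<le> (1 / 2) ^ x * previous n"
      using marginal_pos by (auto simp: previous_def less_imp_le split: nat.split)
    ultimately show ?thesis using less by simp
  next
    case equal
    then show ?thesis
      using marginal_pos by (auto simp: previous_def less_imp_le intro!: add_nonneg_nonneg split: nat.split)
  next
    case greater
    then obtain k where k: "n = Suc k" "x \<le> k" by (cases n) auto
    have "fugacity x * (1 / 2) ^ (k\<^sup>2) \<le> (1 / 2) ^ x"
      using ratio_above[OF k(2)] power_decreasing[OF k(2), of "1 / 2 :: real"] by linarith
    then have "marginal x n \<le> marginal x k * (1 / 2) ^ x"
      unfolding k(1) marginal_Suc using marginal_pos[of x k] by (intro mult_left_mono) auto
    then show ?thesis
      using marginal_pos[of x "Suc n"] greater
      by (simp add: previous_def k(1) mult.commute add_increasing2)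
  qed
  have "summable (\<lambda>n. marginal x n * of_bool (n \<noteq> x))"
    by (rule summable_comparison_test'[OF sums_summable[OF marginal_sums[of x]]])
      (simp add: marginal_pos less_imp_le)
  then have "(\<Sum>n. marginal x n * of_bool (n \<noteq> x)) \<le>
      (1 / 2) ^ x * 1 + 2 * (1 / 2) ^ x * (1 - marginal x 0)"
    by (rule sums_le[OF bound summable_sums sums_add[OF sums_mult[OF previous] sums_mult[OF "next"]]])
  also have "\<dots> \<le> 3 * (1 / 2) ^ x"
    using marginal_pos[of x 0] by (simp add: algebra_simps)
  finally show ?thesis .
qed

definition concentrated_measure :: "config measure" where
  "concentrated_measure = product_measure misanthrope_rate fugacity"

interpretation example: reversible_kernel misanthrope_rate kernel marginal concentrated_measure
proof
  fix x y n m i j :: nat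
  show "0 \<le> kernel x y" by (rule kernel_nonneg)
  show "(\<lambda>(x, y). kernel x y) summable_on UNIV" by (rule kernel_summable)
  show "0 \<le> misanthrope_rate i j" "misanthrope_rate i j \<le> 1" "misanthrope_rate 0 j = 0"
    by (simp_all add: misanthrope_rate_def power_le_one)
  show "0 \<le> marginal x n" by (simp add: marginal_pos less_imp_le)
  show "marginal x sums 1" by (rule marginal_sums)
  show "marginal x (Suc n) * marginal y m * (kernel x y * misanthrope_rate (Suc n) m) =
      marginal x n * marginal y (Suc m) * (kernel y x * misanthrope_rate (Suc m) n)"
  proof -
    have "marginal x (Suc n) * marginal y m * (kernel x y * misanthrope_rate (Suc n) m) =
        (fugacity x * kernel x y) * (marginal x n * marginal y m * (1 / 2) ^ (n\<^sup>2) * (1 / 2) ^ (m\<^sup>2))"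
      by (simp add: marginal_Suc misanthrope_rate_def)
    also have "\<dots> = (fugacity y * kernel y x) * (marginal x n * marginal y m * (1 / 2) ^ (n\<^sup>2) * (1 / 2) ^ (m\<^sup>2))"
      unfolding fugacity_kernel[of x y] ..
    finally show ?thesis by (simp add: marginal_Suc misanthrope_rate_def)
  qed
  show "concentrated_measure = PiM UNIV (\<lambda>x. point_measure UNIV (\<lambda>n. ennreal (marginal x n)))"
    unfolding concentrated_measure_def product_measure_def site_measure_def marginal_def ..
qed

lemma measurable_coordinate [measurable]: "(\<lambda>\<eta>. \<eta> x) \<in> measurable concentrated_measure (count_space UNIV)"
  unfolding measurable_cong_sets[OF example.sets_\<mu> refl] config_space_def
  by (rule measurable_component_singleton) simp

lemma prob_coordinate_ne: "measure concentrated_measure {\<eta>. \<eta> x \<noteq> x} \<le> 3 * (1 / 2) ^ x"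
proof -
  let ?site = "point_measure UNIV (\<lambda>n. ennreal (marginal x n))"
  have "distr concentrated_measure ?site (\<lambda>\<eta>. \<eta> x) = ?site"
    unfolding example.\<mu>_def by (rule distr_PiM_component[OF example.prob_space_site]) auto
  then have "emeasure ?site {n. n \<noteq> x} = emeasure (distr concentrated_measure ?site (\<lambda>\<eta>. \<eta> x)) {n. n \<noteq> x}" by simp
  also have "\<dots> = emeasure concentrated_measure {\<eta>. \<eta> x \<noteq> x}"
    by (subst emeasure_distr) (auto simp: sets_point_measure vimage_def cong: measurable_cong_sets)
  finally have "emeasure concentrated_measure {\<eta>. \<eta> x \<noteq> x} = (\<integral>\<^sup>+n. indicator {n. n \<noteq> x} n \<partial>?site)"
    by (subst nn_integral_indicator) (auto simp: sets_point_measure)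
  also have "\<dots> = (\<Sum>n. ennreal (marginal x n * of_bool (n \<noteq> x)))"
    unfolding example.nn_integral_site by (intro suminf_cong) (simp add: indicator_def)
  also have "\<dots> = ennreal (\<Sum>n. marginal x n * of_bool (n \<noteq> x))"
    by (rule suminf_ennreal2)
      (auto simp: marginal_pos less_imp_le intro!: summable_comparison_test'[OF sums_summable[OF marginal_sums[of x]]])
  also have "\<dots> \<le> ennreal (3 * (1 / 2) ^ x)"
    by (rule ennreal_leI[OF marginal_concentration])
  finally show ?thesis by (simp add: example.emeasure_eq_measure)
qed

text \<open>The first Borel--Cantelli lemma applies because \<open>(1 / 2) ^ x\<close> is summable.\<close>

lemma AE_eventually_coordinate: "AE \<eta> in concentrated_measure. \<forall>\<^sub>F x in sequentially. \<eta> x = x"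
proof -
  have "AE \<eta> in concentrated_measure. \<forall>\<^sub>F x in sequentially. \<eta> \<in> space concentrated_measure - {\<eta>. \<eta> x \<noteq> x}"
  proof (rule borel_cantelli_AE1)
    show "{\<eta>. \<eta> x \<noteq> x} \<in> sets concentrated_measure" for x
      using measurable_sets[OF measurable_coordinate[of x], of "{n. n \<noteq> x}"] by (simp add: vimage_def)
    show "emeasure concentrated_measure {\<eta>. \<eta> x \<noteq> x} < \<infinity>" for x
      by (simp add: example.emeasure_eq_measure)
    show "summable (\<lambda>x. measure concentrated_measure {\<eta>. \<eta> x \<noteq> x})"
      by (rule summable_comparison_test'[where g = "\<lambda>x. 3 * (1 / 2) ^ x"])
        (use prob_coordinate_ne in \<open>auto intro: summable_geometric\<close>)
  qed
  then show ?thesis by simp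
qed

lemma suminf_ennreal_infinite:
  fixes f :: "nat \<Rightarrow> ennreal"
  assumes "\<forall>\<^sub>F n in sequentially. of_nat n \<le> f n"
  shows "suminf f = \<infinity>"
proof (rule ccontr)
  assume "suminf f \<noteq> \<infinity>"
  then obtain N where N: "suminf f < of_nat N" using ennreal_Ex_less_of_nat[of "suminf f"] by (auto simp: less_top)
  obtain n where "N \<le> n" "of_nat n \<le> f n"
    using assms unfolding eventually_sequentially by (meson nle_le)
  moreover have "f n \<le> suminf f" using sum_le_suminf[of f "{n}"] by simp
  ultimately have "of_nat N \<le> suminf f" by (meson of_nat_mono order_trans)
  then show False using N by simp
qed

subsection \<open>Parity of the relative particle number\<close>

text \<open>Since almost surely \<open>\<eta> x = x\<close> for all but finitely many \<open>x\<close>, the relative particle number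
  \<open>\<Sum>x. (\<eta> x - x)\<close> is a finite sum, and jumps preserve it. Only its parity is used, so \<open>\<eta> x - x\<close> may be
  replaced by the natural number \<open>\<eta> x + x\<close>.\<close>

definition partial_number :: "nat \<Rightarrow> config \<Rightarrow> nat" where
  "partial_number n \<eta> = (\<Sum>x<n. \<eta> x + x)"

definition parity_set :: "bool \<Rightarrow> config set" where
  "parity_set c = {\<eta>. \<forall>\<^sub>F n in sequentially. even (partial_number n \<eta>) = c}"

lemma open_partial_number: "open {\<eta>. even (partial_number n \<eta>) = c}"
proof -
  have "continuous_on UNIV (partial_number n)"
    by (rule continuous_on_finite_dependence[where J = "{..<n}"])
      (auto simp: partial_number_def intro!: sum.cong)
  then have "open (partial_number n -` {k. even k = c})"
    by (rule open_vimage[OF Topological_Spaces.open_discrete])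
  then show ?thesis by (simp add: vimage_def)
qed

lemma sets_parity_set [measurable]: "parity_set c \<in> sets concentrated_measure"
proof -
  have "parity_set c = (\<Union>m. \<Inter>n\<in>{m..}. {\<eta>. even (partial_number n \<eta>) = c})"
    by (auto simp: parity_set_def eventually_sequentially)
  also have "\<dots> \<in> sets concentrated_measure"
    using open_partial_number[of _ c]
    by (intro sets.countable_UN sets.countable_INT) (auto simp: example.sets_\<mu>_borel)
  finally show ?thesis .
qed

lemma AE_parity: "AE \<eta> in concentrated_measure. \<exists>c. \<eta> \<in> parity_set c"
  using AE_eventually_coordinate
proof (rule AE_mp, intro AE_I2 impI)
  fix \<eta> assume "\<forall>\<^sub>F x in sequentially. \<eta> x = x"
  then obtain m where m: "\<And>x. m \<le> x \<Longrightarrow> \<eta> x = x" unfolding eventually_sequentially by auto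
  have "even (partial_number n \<eta>) = even (partial_number m \<eta>)" if "m \<le> n" for n
    using that by (induction n rule: dec_induct) (simp_all add: partial_number_def m)
  then show "\<exists>c. \<eta> \<in> parity_set c" unfolding parity_set_def eventually_sequentially by blast
qed

lemma parity_set_unique: "\<eta> \<in> parity_set c \<Longrightarrow> \<eta> \<in> parity_set c' \<Longrightarrow> c = c'"
  unfolding parity_set_def mem_Collect_eq
  by (drule (1) eventually_conj) (auto dest!: eventually_happens)

lemma jump_invariant_parity_set: "example.jump_invariant (parity_set c)"
  unfolding example.jump_invariant_def
proof (intro allI impI)
  fix \<eta> :: config and x y assume x: "0 < \<eta> x"
  have "partial_number n (jump \<eta> x y) = partial_number n \<eta>" if "x < n" "y < n" for n
  proof -
    have "(\<Sum>z<n. jump \<eta> x y z + z + of_bool (z = x)) = (\<Sum>z<n. \<eta> z + z + of_bool (z = y))"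
      using x by (intro sum.cong) (auto simp: jump_def)
    then show ?thesis using that by (simp add: partial_number_def sum.distrib of_bool_def)
  qed
  then have "\<forall>\<^sub>F n in sequentially. partial_number n (jump \<eta> x y) = partial_number n \<eta>"
    unfolding eventually_sequentially by (intro exI[of _ "Suc (max x y)"]) auto
  then show "jump \<eta> x y \<in> parity_set c \<longleftrightarrow> \<eta> \<in> parity_set c"
    unfolding parity_set_def mem_Collect_eq by (intro eventually_subst) (auto elim: eventually_mono)
qed

lemma parity_set_fun_upd: "\<eta>(0 := Suc k) \<in> parity_set c \<longleftrightarrow> \<eta>(0 := k) \<in> parity_set (\<not> c)"
proof -
  have "even (partial_number n (\<eta>(0 := Suc k))) \<noteq> even (partial_number n (\<eta>(0 := k)))" if n: "0 < n" for n
  proof -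
    obtain m where "n = Suc m" using gr0_implies_Suc[OF n] by auto
    have "partial_number (Suc m) (\<eta>(0 := l)) = l + (\<Sum>x<m. \<eta> (Suc x) + Suc x)" for l
      unfolding partial_number_def sum.lessThan_Suc_shift by simp
    then show ?thesis unfolding \<open>n = Suc m\<close> by simp
  qed
  then have "\<forall>\<^sub>F n in sequentially. (even (partial_number n (\<eta>(0 := Suc k))) = c) =
      (even (partial_number n (\<eta>(0 := k))) = (\<not> c))"
    unfolding eventually_sequentially by (intro exI[of _ 1]) auto
  then show ?thesis
    unfolding parity_set_def mem_Collect_eq by (rule eventually_subst)
qed

text \<open>One more particle at site \<open>0\<close> exchanges the two parity sets, and resampling site \<open>0\<close> gives
  positive weight to every occupation number there.\<close>

lemma parity_set_null:
  assumes "measure concentrated_measure (parity_set c) = 0"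
  shows "measure concentrated_measure (parity_set (\<not> c)) = 0"
proof -
  have resample: "emeasure concentrated_measure (parity_set c) =
      (\<Sum>k. ennreal (marginal 0 k) * (\<integral>\<^sup>+\<eta>. indicator (parity_set c) (\<eta>(0 := k)) \<partial>concentrated_measure))" for c
    using example.nn_integral_resample[of "indicator (parity_set c)" 0] by simp
  define I where "I k = (\<integral>\<^sup>+\<eta>. indicator (parity_set c) (\<eta>(0 := k)) \<partial>concentrated_measure)" for k
  have "emeasure concentrated_measure (parity_set c) = 0"
    using assms by (simp add: example.emeasure_eq_measure)
  then have "(\<Sum>k. ennreal (marginal 0 k) * I k) = 0"
    unfolding resample I_def .
  then have "ennreal (marginal 0 k) * I k = 0" for k
    by (simp only: suminf_eq_zero_iff[OF summableI zero_le])
  moreover have "ennreal (marginal 0 k) \<noteq> 0" for k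
    using marginal_pos[of 0 k] by simp
  ultimately have zero: "I k = 0" for k by (metis mult_eq_0_iff)
  have "indicator (parity_set (\<not> c)) (\<eta>(0 := k)) = (indicator (parity_set c) (\<eta>(0 := Suc k)) :: ennreal)" for \<eta> k
    using parity_set_fun_upd[of \<eta> k c] by (simp add: indicator_def)
  then have "emeasure concentrated_measure (parity_set (\<not> c)) = 0"
    unfolding resample by (simp add: zero[unfolded I_def])
  then show ?thesis by (simp add: measure_def)
qed

lemma measure_parity_set: "measure concentrated_measure (parity_set c) \<notin> {0, 1}"
proof -
  have "parity_set True \<union> parity_set False = {\<eta> \<in> space concentrated_measure. \<exists>c. \<eta> \<in> parity_set c}"
    unfolding ex_bool_eq by auto
  moreover have "measure concentrated_measure {\<eta> \<in> space concentrated_measure. \<exists>c. \<eta> \<in> parity_set c} = 1"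
    using AE_parity by (subst example.prob_Collect_eq_1) auto
  moreover have "parity_set True \<inter> parity_set False = {}"
    using parity_set_unique by blast
  ultimately have total: "measure concentrated_measure (parity_set True) + measure concentrated_measure (parity_set False) = 1"
    using example.finite_measure_Union[of "parity_set True" "parity_set False"] by simp
  have "measure concentrated_measure (parity_set True) \<noteq> 0" "measure concentrated_measure (parity_set False) \<noteq> 0"
    using parity_set_null[of True] parity_set_null[of False] total by force+
  then show ?thesis using total by (cases c) auto
qed

text \<open>Local approximations of the invariant indicator. Each depends on finitely many sites, so it is
  in the core although the limit depends on all sites.\<close>

definition parity_indicator :: "nat \<Rightarrow> config \<Rightarrow>\<^sub>C real" where
  "parity_indicator n = Bcontfun (\<lambda>\<eta>. of_bool (even (partial_number n \<eta>)))"

lemma apply_parity_indicator: "apply_bcontfun (parity_indicator n) \<eta> = of_bool (even (partial_number n \<eta>))"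
proof -
  have "apply_bcontfun (parity_indicator n) = (\<lambda>\<eta>. of_bool (even (partial_number n \<eta>)))"
    unfolding parity_indicator_def
  proof (rule apply_Bcontfun)
    show "continuous_on UNIV (\<lambda>\<eta>. of_bool (even (partial_number n \<eta>)) :: real)"
      by (rule continuous_on_finite_dependence[where J = "{..<n}"])
        (simp_all add: partial_number_def)
    show "\<bar>of_bool (even (partial_number n \<eta>)) :: real\<bar> \<le> 1" for \<eta> by simp
  qed
  then show ?thesis by simp
qed

lemma parity_indicator_core_D: "parity_indicator n \<in> core_D"
  by (rule core_D_finite_dependence[where J = "{..<n}"])
    (simp_all add: apply_parity_indicator partial_number_def)

lemma parity_indicator_converges:
  "L2_converges concentrated_measure parity_indicator (indicator (parity_set True))"
proof -
  let ?I = "indicator (parity_set True) :: config \<Rightarrow> real"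
  have "(\<lambda>n. \<integral>\<eta>. (apply_bcontfun (parity_indicator n) \<eta> - ?I \<eta>)\<^sup>2 \<partial>concentrated_measure) \<longlonglongrightarrow> (\<integral>\<eta>. 0 \<partial>concentrated_measure)"
  proof (rule integral_dominated_convergence[where w = "\<lambda>_. 1"])
    show "AE \<eta> in concentrated_measure. (\<lambda>n. (apply_bcontfun (parity_indicator n) \<eta> - ?I \<eta>)\<^sup>2) \<longlonglongrightarrow> 0"
      using AE_parity
    proof (rule AE_mp, intro AE_I2 impI)
      fix \<eta> assume "\<exists>c. \<eta> \<in> parity_set c"
      then obtain c where c: "\<eta> \<in> parity_set c" ..
      then have I: "?I \<eta> = of_bool c" using parity_set_unique[of \<eta> c True] by (auto simp: indicator_def)
      have ev: "\<forall>\<^sub>F n in sequentially. even (partial_number n \<eta>) = c"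
        using c by (simp add: parity_set_def)
      have "\<forall>\<^sub>F n in sequentially. (apply_bcontfun (parity_indicator n) \<eta> - ?I \<eta>)\<^sup>2 = 0"
        using ev by (rule eventually_mono) (simp add: apply_parity_indicator I)
      then show "(\<lambda>n. (apply_bcontfun (parity_indicator n) \<eta> - ?I \<eta>)\<^sup>2) \<longlonglongrightarrow> 0"
        by (rule tendsto_eventually)
    qed
    show "AE \<eta> in concentrated_measure. norm ((apply_bcontfun (parity_indicator n) \<eta> - ?I \<eta>)\<^sup>2) \<le> 1" for n
      by (rule AE_I2) (simp add: apply_parity_indicator indicator_def)
  qed measurable
  then show ?thesis by (simp add: L2_converges_def)
qed

lemma infinitely_many_particles:
  "measure concentrated_measure {\<eta> \<in> space concentrated_measure. (\<Sum>i. of_nat (\<eta> i) :: ennreal) = \<infinity>} = 1"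
proof (subst example.prob_Collect_eq_1)
  have [measurable]: "(\<lambda>\<eta>. of_nat (\<eta> i) :: ennreal) \<in> borel_measurable concentrated_measure" for i
    by (intro example.measurable_continuous continuous_on_finite_dependence[where J = "{i}"]) auto
  show "{\<eta> \<in> space concentrated_measure. (\<Sum>i. of_nat (\<eta> i) :: ennreal) = \<infinity>} \<in> sets concentrated_measure" by measurable
  show "AE \<eta> in concentrated_measure. (\<Sum>i. of_nat (\<eta> i) :: ennreal) = \<infinity>"
    using AE_eventually_coordinate
    by (rule AE_mp)
      (intro AE_I2 impI suminf_ennreal_infinite, auto elim: eventually_mono)
qed

theorem mainTheorem5:
  shows "\<exists>(p :: nat \<Rightarrow> nat \<Rightarrow> real) (b :: nat \<Rightarrow> nat \<Rightarrow> real) (lam :: nat \<Rightarrow> real)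
           (S :: real \<Rightarrow> (config \<Rightarrow>\<^sub>C real) \<Rightarrow> (config \<Rightarrow>\<^sub>C real)).
    standing_assumptions b p \<and>
    bounded (range (\<lambda>(i, j). b i j)) \<and>
    (\<forall>x. 0 \<le> lam x \<and> ereal (lam x) < lambda_star b) \<and>
    (\<Sum>i. ennreal (lam i)) = \<infinity> \<and>
    generates b p S \<and>
    product_measure b lam \<in> stationary_measures S \<and>
    measure (product_measure b lam)
      {\<eta> \<in> space (product_measure b lam). (\<Sum>i. of_nat (\<eta> i) :: ennreal) = \<infinity>} = 1 \<and>
    \<not> ergodic S (product_measure b lam)"
proof (intro exI conjI)
  show "standing_assumptions misanthrope_rate kernel" by (rule standing_assumptions_example)
  show "bounded (range (\<lambda>(i, j). misanthrope_rate i j))"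
    by (rule boundedI[where B = 1]) (auto simp: misanthrope_rate_def power_le_one)
  show "\<forall>x. 0 \<le> fugacity x \<and> ereal (fugacity x) < lambda_star misanthrope_rate"
    by (simp add: lambda_star_example fugacity_pos less_imp_le)
  have "\<forall>\<^sub>F n in sequentially. of_nat n \<le> ennreal (fugacity n)"
    using fugacity_ge unfolding eventually_sequentially
    by (intro exI[of _ 2]) (auto simp: ennreal_of_nat_eq_real_of_nat intro!: ennreal_leI)
  then show "(\<Sum>i. ennreal (fugacity i)) = \<infinity>" by (rule suminf_ennreal_infinite)
  show "generates misanthrope_rate kernel example.semigroup" by (rule example.generates_semigroup)
  show "product_measure misanthrope_rate fugacity \<in> stationary_measures example.semigroup"
    using example.stationary unfolding concentrated_measure_def .
  show "measure (product_measure misanthrope_rate fugacity)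
      {\<eta> \<in> space (product_measure misanthrope_rate fugacity).
        (\<Sum>i. of_nat (\<eta> i) :: ennreal) = \<infinity>} = 1"
    using infinitely_many_particles unfolding concentrated_measure_def .
  have "\<not> ergodic example.semigroup concentrated_measure"
    by (rule example.not_ergodic[OF sets_parity_set jump_invariant_parity_set measure_parity_set
          subsetD[OF closure_subset parity_indicator_core_D] parity_indicator_converges])
  then show "\<not> ergodic example.semigroup (product_measure misanthrope_rate fugacity)"
    unfolding concentrated_measure_def .
qed

end
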